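(* Let $a>0$, $c>0$ and $s_0\in\mathbb{R}$. There exists a constant $C>0$, depending on $a$, $c$ and $s_0$, with the following property. Let $\kappa,\tau:\mathbb{R}\to\mathbb{R}$ be bounded continuous functions such that either $\kappa$ is positive or $\kappa$ and $\tau$ both vanish identically, and let $\theta:\mathbb{R}\to\mathbb{R}$ be a bounded $C^1$ function with bounded (continuous) derivative $\dot\theta$. Assume that $\tau-\dot\theta$ is not identically zero, that $a\,\|\tau-\dot\theta\|_\infty<\sqrt2$, that $(s_0,c)$ is a Hardy pair for $(a,\tau-\dot\theta)$ (as defined in the context), and that $$|\kappa(s)\cos\theta(s)|\ \le\ \frac{\varepsilon_0}{1+s^2}\qquad\text{for all } s\in\mathbb{R},$$ for some $\varepsilon_0\in[0,a^{-1})$. If $\varepsilon_0\le C$, then $$-\Delta_D^{\Omega}\ \ge\ E_1$$ in the sense of quadratic forms, i.e. $Q[\psi]\ge E_1\|\psi\|_{\mathcal{H}}^2$ for all $\psi\in W_0^{1,2}(\mathbb{R}\times(-a,a))$.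
   Context: $E_1:=\pi^2/(2a)^2$; $\|\cdot\|_\infty$ is the supremum norm on $\mathbb{R}$; $\partial_1=\partial/\partial s$, $\partial_2=\partial/\partial t$. The ruled strip $\Omega$ is the Riemannian manifold $\mathbb{R}\times(-a,a)$ with metric $G=\mathrm{diag}(h^2,1)$ in the coordinates $(s,t)$, where $$h(s,t):=\sqrt{[1-t\,\kappa(s)\cos\theta(s)]^2+t^2[\tau(s)-\dot\theta(s)]^2},$$ under the standing assumption $a\,\|\kappa\cos\theta\|_\infty<1$ (which here follows from $\varepsilon_0<a^{-1}$). Put $\mathcal{H}:=L^2(\mathbb{R}\times(-a,a),\,h(s,t)\,ds\,dt)$. The Dirichlet Laplacian $-\Delta_D^\Omega$ is the self-adjoint operator in $\mathcal{H}$ associated with the closure $Q$ of the form $Q[\psi]=\|h^{-1}\partial_1\psi\|_{\mathcal{H}}^2+\|\partial_2\psi\|_{\mathcal{H}}^2$ defined on $C_0^\infty(\mathbb{R}\times(-a,a))$; the form domain is $W_0^{1,2}(\mathbb{R}\times(-a,a))$. Hardy pair: let $h_0(s,t):=\sqrt{1+t^2[\tau(s)-\dot\theta(s)]^2}$, $\mathcal{H}_0:=L^2(\mathbb{R}\times(-a,a),\,h_0(s,t)\,ds\,dt)$ and $Q_0[\psi]:=\|h_0^{-1}\partial_1\psi\|_{\mathcal{H}_0}^2+\|\partial_2\psi\|_{\mathcal{H}_0}^2$ for $\psi\in W_0^{1,2}(\mathbb{R}\times(-a,a))$. A pair $(s_0,c)$ with $s_0\in\mathbb{R}$, $(\tau-\dot\theta)(s_0)\ne0$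 and $c>0$ is called a Hardy pair for $(a,\tau-\dot\theta)$ if $$Q_0[\psi]-E_1\|\psi\|_{\mathcal{H}_0}^2\ge c\int_{\mathbb{R}\times(-a,a)}\frac{|\psi(s,t)|^2}{1+(s-s_0)^2}\,h_0(s,t)\,ds\,dt\quad\text{for all }\psi\in W_0^{1,2}(\mathbb{R}\times(-a,a)).$$ It is known that if $\tau-\dot\theta$ is bounded, continuous, not identically zero and $a\|\tau-\dot\theta\|_\infty<\sqrt2$, then for every $s_0$ with $(\tau-\dot\theta)(s_0)\ne0$ there is a $c>0$ such that $(s_0,c)$ is a Hardy pair. *)

theory Defs
  imports "HOL-Analysis.Analysis"
begin

section \<open>Square-integrable functions on the strip\<close>

text \<open>
  Elements of an $L^2$ space are represented by measurable functions; everything below depends on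
  them only up to almost everywhere equality on the strip.
\<close>

definition strip :: "real \<Rightarrow> (real \<times> real) set" where
  "strip a = UNIV \<times> {-a<..<a}"

definition strip_measure :: "real \<Rightarrow> (real \<times> real \<Rightarrow> real) \<Rightarrow> (real \<times> real) measure" where
  "strip_measure a w = density (restrict_space lborel (strip a)) (\<lambda>p. ennreal (w p))"

definition L2_functions :: "'a measure \<Rightarrow> ('a \<Rightarrow> complex) set" where
  "L2_functions M = {f \<in> borel_measurable M. integrable M (\<lambda>x. (cmod (f x))\<^sup>2)}"

definition L2_norm_sq :: "'a measure \<Rightarrow> ('a \<Rightarrow> complex) \<Rightarrow> real" where
  "L2_norm_sq M f = (LINT x|M. (cmod (f x))\<^sup>2)"


section \<open>Test functions and Sobolev spaces\<close>

definition partial1 :: "(real \<times> real \<Rightarrow> complex) \<Rightarrow> real \<times> real \<Rightarrow> complex" where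
  "partial1 f = (\<lambda>(s, t). vector_derivative (\<lambda>x. f (x, t)) (at s))"

definition partial2 :: "(real \<times> real \<Rightarrow> complex) \<Rightarrow> real \<times> real \<Rightarrow> complex" where
  "partial2 f = (\<lambda>(s, t). vector_derivative (\<lambda>y. f (s, y)) (at t))"

text \<open>All partial derivatives up to order \<open>k\<close> exist and are continuous.\<close>

primrec C_k :: "nat \<Rightarrow> (real \<times> real \<Rightarrow> complex) \<Rightarrow> bool" where
  "C_k 0 f \<longleftrightarrow> continuous_on UNIV f"
| "C_k (Suc k) f \<longleftrightarrow>
     continuous_on UNIV f \<and>
     (\<forall>s t. (\<lambda>x. f (x, t)) differentiable (at s) \<and> (\<lambda>y. f (s, y)) differentiable (at t)) \<and>
     C_k k (partial1 f) \<and> C_k k (partial2 f)"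

text \<open>
  The space $C_0^\infty$ of the strip; its elements are extended by zero to the whole plane.
\<close>

definition test_functions :: "real \<Rightarrow> (real \<times> real \<Rightarrow> complex) set" where
  "test_functions a =
     {\<phi>. (\<forall>k. C_k k \<phi>) \<and> compact (closure {p. \<phi> p \<noteq> 0}) \<and> closure {p. \<phi> p \<noteq> 0} \<subseteq> strip a}"

text \<open>Unweighted Lebesgue measure on the strip.\<close>

abbreviation strip_lebesgue :: "real \<Rightarrow> (real \<times> real) measure" where
  "strip_lebesgue a \<equiv> strip_measure a (\<lambda>_. 1)"

definition has_weak_gradient ::
  "real \<Rightarrow> (real \<times> real \<Rightarrow> complex) \<Rightarrow> (real \<times> real \<Rightarrow> complex) \<Rightarrow> (real \<times> real \<Rightarrow> complex) \<Rightarrow> bool"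
where
  "has_weak_gradient a \<psi> g1 g2 \<longleftrightarrow>
     \<psi> \<in> L2_functions (strip_lebesgue a) \<and>
     g1 \<in> L2_functions (strip_lebesgue a) \<and> g2 \<in> L2_functions (strip_lebesgue a) \<and>
     (\<forall>\<phi>\<in>test_functions a.
        (LINT p|strip_lebesgue a. \<psi> p * partial1 \<phi> p) = - (LINT p|strip_lebesgue a. g1 p * \<phi> p) \<and>
        (LINT p|strip_lebesgue a. \<psi> p * partial2 \<phi> p) = - (LINT p|strip_lebesgue a. g2 p * \<phi> p))"

text \<open>$W_0^{1,2}$: the closure of the test functions in the norm of $W^{1,2}$.\<close>

definition W12_0 :: "real \<Rightarrow> (real \<times> real \<Rightarrow> complex) set" where
  "W12_0 a =
     {\<psi>. \<exists>g1 g2. has_weak_gradient a \<psi> g1 g2 \<and>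
        (\<exists>\<phi>. (\<forall>n::nat. \<phi> n \<in> test_functions a) \<and>
           (\<lambda>n. L2_norm_sq (strip_lebesgue a) (\<lambda>p. \<phi> n p - \<psi> p)
              + L2_norm_sq (strip_lebesgue a) (\<lambda>p. partial1 (\<phi> n) p - g1 p)
              + L2_norm_sq (strip_lebesgue a) (\<lambda>p. partial2 (\<phi> n) p - g2 p)) \<longlonglongrightarrow> 0)}"


section \<open>Quadratic forms\<close>

text \<open>
  The energy of a function with gradient \<open>(g1, g2)\<close> with respect to the metric
  $\mathrm{diag}(h^2, 1)$, whose volume element is $h\,ds\,dt$.
\<close>

definition energy ::
  "real \<Rightarrow> (real \<times> real \<Rightarrow> real) \<Rightarrow> (real \<times> real \<Rightarrow> complex) \<Rightarrow> (real \<times> real \<Rightarrow> complex) \<Rightarrow> real"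
where
  "energy a h g1 g2 =
     L2_norm_sq (strip_measure a h) (\<lambda>p. g1 p / complex_of_real (h p)) +
     L2_norm_sq (strip_measure a h) g2"

text \<open>
  Closure of a quadratic form \<open>q\<close> with domain \<open>D\<close> in $L^2(M)$: \<open>\<psi>\<close> lies in the domain of the
  closure, with value \<open>v\<close>, if some form-Cauchy sequence in \<open>D\<close> converges to \<open>\<psi>\<close> in $L^2(M)$ and its
  form values converge to \<open>v\<close>.  The value is unique when the form is closable.
\<close>

definition form_closure_rel ::
  "'a measure \<Rightarrow> ('a \<Rightarrow> complex) set \<Rightarrow> (('a \<Rightarrow> complex) \<Rightarrow> real) \<Rightarrow> ('a \<Rightarrow> complex) \<Rightarrow> real \<Rightarrow> bool"
where
  "form_closure_rel M D q \<psi> v \<longleftrightarrow>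
     \<psi> \<in> L2_functions M \<and>
     (\<exists>\<phi>. (\<forall>n::nat. \<phi> n \<in> D) \<and>
        (\<lambda>n. L2_norm_sq M (\<lambda>x. \<phi> n x - \<psi> x)) \<longlonglongrightarrow> 0 \<and>
        (\<forall>e>0. \<exists>N. \<forall>m\<ge>N. \<forall>n\<ge>N. q (\<lambda>x. \<phi> m x - \<phi> n x) < e) \<and>
        (\<lambda>n. q (\<phi> n)) \<longlonglongrightarrow> v)"

definition form_closure ::
  "'a measure \<Rightarrow> ('a \<Rightarrow> complex) set \<Rightarrow> (('a \<Rightarrow> complex) \<Rightarrow> real) \<Rightarrow> ('a \<Rightarrow> complex) \<Rightarrow> real"
where
  "form_closure M D q \<psi> = (THE v. form_closure_rel M D q \<psi> v)"

text \<open>The form of the Dirichlet Laplacian for the metric $\mathrm{diag}(h^2, 1)$.\<close>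

definition Dirichlet_form ::
  "real \<Rightarrow> (real \<times> real \<Rightarrow> real) \<Rightarrow> (real \<times> real \<Rightarrow> complex) \<Rightarrow> real"
where
  "Dirichlet_form a h =
     form_closure (strip_measure a h) (test_functions a)
       (\<lambda>\<phi>. energy a h (partial1 \<phi>) (partial2 \<phi>))"


section \<open>Ruled strips and Hardy pairs\<close>

definition E1 :: "real \<Rightarrow> real" where
  "E1 a = pi\<^sup>2 / (2 * a)\<^sup>2"

definition h_ruled ::
  "(real \<Rightarrow> real) \<Rightarrow> (real \<Rightarrow> real) \<Rightarrow> (real \<Rightarrow> real) \<Rightarrow> real \<times> real \<Rightarrow> real"
where
  "h_ruled \<kappa> \<tau> \<theta> =
     (\<lambda>(s, t). sqrt ((1 - t * \<kappa> s * cos (\<theta> s))\<^sup>2 + t\<^sup>2 * (\<tau> s - deriv \<theta> s)\<^sup>2))"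

definition h_twist :: "(real \<Rightarrow> real) \<Rightarrow> real \<times> real \<Rightarrow> real" where
  "h_twist \<sigma> = (\<lambda>(s, t). sqrt (1 + t\<^sup>2 * (\<sigma> s)\<^sup>2))"

text \<open>
  Here \<open>\<sigma>\<close> stands for $\tau - \dot\theta$.  Weak gradients are unique up to null sets and the
  energy is insensitive to null sets, so quantifying over \<open>g1\<close> and \<open>g2\<close> amounts to inserting
  the weak gradient of \<open>\<psi>\<close>.
\<close>

definition Hardy_pair :: "real \<Rightarrow> (real \<Rightarrow> real) \<Rightarrow> real \<Rightarrow> real \<Rightarrow> bool" where
  "Hardy_pair a \<sigma> s0 c \<longleftrightarrow>
     \<sigma> s0 \<noteq> 0 \<and> c > 0 \<and>
     (\<forall>\<psi>\<in>W12_0 a. \<forall>g1 g2. has_weak_gradient a \<psi> g1 g2 \<longrightarrow>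
        energy a (h_twist \<sigma>) g1 g2 - E1 a * L2_norm_sq (strip_measure a (h_twist \<sigma>)) \<psi>
        \<ge> c * (LINT p|strip_measure a (h_twist \<sigma>). (cmod (\<psi> p))\<^sup>2 / (1 + (fst p - s0)\<^sup>2)))"

end

theory Submission
  imports Defs
begin

text \<open>
  Write $h_0$ for the twisted weight, $k = \kappa \cos\theta$ and
  $\delta(s) = a \varepsilon_0 / (1 + s^2)$, which bounds $|t k(s)|$. Then
  $(1 - \delta) h_0 \le h \le (1 + \delta) h_0$, so for a test function $\varphi$ and $\delta \le 1/2$
  \[ Q[\varphi] - E_1 \|\varphi\|^2 \ge \frac12 \bigl( Q_0[\varphi] - E_1 \|\varphi\|_0^2 \bigr)
     + \int \Bigl( \frac12 - \delta \Bigr) \bigl( |\partial_2 \varphi|^2 - E_1 |\varphi|^2 \bigr) h_0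
     - 2 E_1 \int \delta |\varphi|^2 h_0 . \]
  The middle term is nonnegative because already the transverse integral is nonnegative for every $s$;
  this is where $a \|\tau - \dot\theta\|_\infty < \sqrt2$ enters. The last term is dominated by the
  Hardy term for small $\varepsilon_0$. The estimate passes to the closure of the form, which is well
  defined: since $h$ and $1/h$ are bounded, its closability reduces to that of the flat Dirichlet form.
\<close>

section \<open>Square-integrable functions\<close>

text \<open>Passing from \<open>h0\<close> to \<open>h\<close> costs a fraction \<delta> of the
  transverse gradient, but the Hardy inequality returns only a weighted mass, never a gradient. So
  just half of the gap estimate is spent on it; the other half keeps a transverse gradient to pay
  from. What is left has a weight depending on s, hence the inequality on every segment s = const.
  Once the gradient is balanced against E_1, the only excess is mass with factor 2 \<delta>, whose
  decay 1 / (1 + s^2) is that of the Hardy weight.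

  On a segment the comparison function w^(-1/2) cos (\<beta> t) comes from the Liouville
  substitution: cos (\<beta> t) with \<beta> = pi / (2 a) is the Dirichlet ground state of the flat
  interval, and w^(-1/2) removes the first-order term. The potential so created is \<sigma>^2 (2 -
  t^2 \<sigma>^2) / (4 w^4), nonnegative as long as t^2 \<sigma>^2 \<le> 2.

  \<open>form_closure\<close> is a definite description, so any bound on it first needs existence
  and uniqueness of the limit of the form values.\<close>

lemma L2_norm_sq_nonneg: "0 \<le> L2_norm_sq M f"
  unfolding L2_norm_sq_def by (rule Bochner_Integration.integral_nonneg) simp

lemma cmod_diff_sq_le: "(cmod (x - y))\<^sup>2 \<le> 2 * (cmod x)\<^sup>2 + 2 * (cmod y)\<^sup>2"
proof -
  have "(cmod (x - y))\<^sup>2 \<le> (cmod x + cmod y)\<^sup>2"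
    by (simp add: norm_triangle_ineq4 power_mono)
  also have "\<dots> \<le> 2 * (cmod x)\<^sup>2 + 2 * (cmod y)\<^sup>2"
    using sum_squares_bound[of "cmod x" "cmod y"] by (simp add: power2_sum)
  finally show ?thesis .
qed

text \<open>Young's inequality with the parameter left free. It survives integration and addition of
  norms; choosing \<eta> afterwards gives the triangle inequality for weighted norms and energies
  alike.\<close>

lemma cmod_sq_le_peter_paul:
  assumes "\<eta> > 0"
  shows "(cmod x)\<^sup>2 \<le> (1 + \<eta>) * (cmod y)\<^sup>2 + (1 + 1 / \<eta>) * (cmod (x - y))\<^sup>2"
proof -
  let ?b = "cmod y" and ?d = "cmod (x - y)"
  have "cmod x \<le> ?b + ?d"
    using norm_triangle_ineq[of y "x - y"] by simp
  then have "(cmod x)\<^sup>2 \<le> (?b + ?d)\<^sup>2"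
    by (simp add: power_mono)
  also have "\<dots> \<le> (1 + \<eta>) * ?b\<^sup>2 + (1 + 1 / \<eta>) * ?d\<^sup>2"
  proof -
    have "0 \<le> (\<eta> * ?b - ?d)\<^sup>2 / \<eta>"
      using assms by simp
    also have "\<dots> = \<eta> * ?b\<^sup>2 - 2 * ?b * ?d + ?d\<^sup>2 / \<eta>"
      using assms by (simp add: field_simps power2_eq_square)
    finally show ?thesis
      by (simp add: algebra_simps power2_sum)
  qed
  finally show ?thesis .
qed

lemma L2_functions_diff:
  assumes "f \<in> L2_functions M" "g \<in> L2_functions M"
  shows "(\<lambda>x. f x - g x) \<in> L2_functions M"
proof -
  have [measurable]: "f \<in> borel_measurable M" "g \<in> borel_measurable M"
    using assms by (auto simp: L2_functions_def)
  have "integrable M (\<lambda>x. 2 * (cmod (f x))\<^sup>2 + 2 * (cmod (g x))\<^sup>2)"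
    using assms by (auto simp: L2_functions_def)
  then have "integrable M (\<lambda>x. (cmod (f x - g x))\<^sup>2)"
    by (rule Bochner_Integration.integrable_bound) (auto intro!: AE_I2 simp: cmod_diff_sq_le)
  then show ?thesis
    by (simp add: L2_functions_def)
qed

lemma L2_norm_sq_diff_le:
  assumes "f \<in> L2_functions M" "g \<in> L2_functions M"
  shows "L2_norm_sq M (\<lambda>x. f x - g x) \<le> 2 * L2_norm_sq M f + 2 * L2_norm_sq M g"
proof -
  have "L2_norm_sq M (\<lambda>x. f x - g x) \<le> (LINT x|M. 2 * (cmod (f x))\<^sup>2 + 2 * (cmod (g x))\<^sup>2)"
    unfolding L2_norm_sq_def using assms L2_functions_diff[OF assms]
    by (intro integral_mono) (auto simp: cmod_diff_sq_le L2_functions_def)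
  then show ?thesis
    using assms by (simp add: L2_norm_sq_def L2_functions_def)
qed

lemma L2_norm_sq_peter_paul:
  assumes "f \<in> L2_functions M" "g \<in> L2_functions M" "\<eta> > 0"
  shows "L2_norm_sq M f \<le> (1 + \<eta>) * L2_norm_sq M g + (1 + 1 / \<eta>) * L2_norm_sq M (\<lambda>x. f x - g x)"
proof -
  note d = L2_functions_diff[OF assms(1,2)]
  have "L2_norm_sq M f
      \<le> (LINT x|M. (1 + \<eta>) * (cmod (g x))\<^sup>2 + (1 + 1 / \<eta>) * (cmod (f x - g x))\<^sup>2)"
    unfolding L2_norm_sq_def using assms d
    by (intro integral_mono) (auto simp: cmod_sq_le_peter_paul L2_functions_def)
  also have "\<dots> = (1 + \<eta>) * L2_norm_sq M g + (1 + 1 / \<eta>) * L2_norm_sq M (\<lambda>x. f x - g x)"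
    unfolding L2_norm_sq_def using assms d
    by (subst Bochner_Integration.integral_add) (auto simp: L2_functions_def)
  finally show ?thesis .
qed

section \<open>Triangle inequalities for roots of quadratic expressions\<close>

lemma sqrt_le_of_peter_paul:
  fixes A B D :: real
  assumes "0 \<le> B" "0 \<le> D"
    and le: "\<And>\<eta>. \<eta> > 0 \<Longrightarrow> A \<le> (1 + \<eta>) * B + (1 + 1 / \<eta>) * D"
  shows "sqrt A \<le> sqrt B + sqrt D"
proof -
  \<comment> \<open>The right-hand side is smallest at \<eta> = sqrt D / sqrt B. Adding e to both
    roots keeps this ratio defined and positive when B or D is 0.\<close>
  have *: "A \<le> (sqrt B + e + (sqrt D + e))\<^sup>2" if "e > 0" for e
  proof -
    define b d where "b = sqrt B + e" and "d = sqrt D + e"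
    have pos: "b > 0" "d > 0"
      using that assms by (auto simp: b_def d_def add_nonneg_pos)
    have "B \<le> b\<^sup>2" "D \<le> d\<^sup>2"
      using that assms power_mono[of "sqrt B" b 2] power_mono[of "sqrt D" d 2]
      by (auto simp: b_def d_def)
    then have "(1 + d / b) * B + (1 + 1 / (d / b)) * D \<le> (1 + d / b) * b\<^sup>2 + (1 + 1 / (d / b)) * d\<^sup>2"
      using pos by (intro add_mono mult_left_mono) auto
    also have "\<dots> = (b + d)\<^sup>2"
      using pos by (simp add: field_simps power2_eq_square)
    finally show ?thesis
      using le[of "d / b"] pos by (simp add: b_def d_def)
  qed
  have "sqrt A \<le> sqrt B + sqrt D + 2 * e" if "e > 0" for e
    using *[OF that] that assms by (intro real_le_lsqrt) (auto simp: algebra_simps)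
  then have "sqrt A \<le> sqrt B + sqrt D + e" if "e > 0" for e
    using that[THEN half_gt_zero] by fastforce
  then show ?thesis
    by (rule field_le_epsilon)
qed

lemma sqrt_dist_of_peter_paul:
  fixes A B D :: real
  assumes "0 \<le> A" "0 \<le> B" "0 \<le> D"
    and "\<And>\<eta>. \<eta> > 0 \<Longrightarrow> A \<le> (1 + \<eta>) * B + (1 + 1 / \<eta>) * D"
    and "\<And>\<eta>. \<eta> > 0 \<Longrightarrow> B \<le> (1 + \<eta>) * A + (1 + 1 / \<eta>) * D"
  shows "\<bar>sqrt A - sqrt B\<bar> \<le> sqrt D"
  using sqrt_le_of_peter_paul[of B D A] sqrt_le_of_peter_paul[of A D B] assms by simp

text \<open>Norms and energies are squares of seminorms and only their roots obey a triangle
  inequality; so the limit is taken for the roots and then squared.\<close>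

lemma tendsto_of_sqrt_dist:
  fixes A D :: "nat \<Rightarrow> real" and B :: real
  assumes A: "\<And>n. 0 \<le> A n" and B: "0 \<le> B" and D: "D \<longlonglongrightarrow> 0"
    and le: "\<And>n. \<bar>sqrt (A n) - sqrt B\<bar> \<le> sqrt (D n)"
  shows "A \<longlonglongrightarrow> B"
proof -
  have "(\<lambda>n. sqrt (D n)) \<longlonglongrightarrow> 0"
    using tendsto_real_sqrt[OF D] by simp
  then have "(\<lambda>n. sqrt (A n) - sqrt B) \<longlonglongrightarrow> 0"
    by (rule Lim_null_comparison[rotated]) (simp add: le)
  then have "(\<lambda>n. sqrt (A n)) \<longlonglongrightarrow> sqrt B"
    by (simp add: LIM_zero_iff)
  then have "(\<lambda>n. (sqrt (A n))\<^sup>2) \<longlonglongrightarrow> (sqrt B)\<^sup>2"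
    by (rule tendsto_power)
  then show ?thesis
    unfolding real_sqrt_pow2[OF A] real_sqrt_pow2[OF B] .
qed

lemma L2_norm_sq_sqrt_dist:
  assumes f: "f \<in> L2_functions M" and g: "g \<in> L2_functions M"
  shows "\<bar>sqrt (L2_norm_sq M f) - sqrt (L2_norm_sq M g)\<bar> \<le> sqrt (L2_norm_sq M (\<lambda>x. f x - g x))"
proof (rule sqrt_dist_of_peter_paul)
  have sym: "L2_norm_sq M (\<lambda>x. g x - f x) = L2_norm_sq M (\<lambda>x. f x - g x)"
    by (simp add: L2_norm_sq_def norm_minus_commute)
  show "L2_norm_sq M g \<le> (1 + \<eta>) * L2_norm_sq M f + (1 + 1 / \<eta>) * L2_norm_sq M (\<lambda>x. f x - g x)"
    if "\<eta> > 0" for \<eta>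
    using L2_norm_sq_peter_paul[OF g f that] by (simp only: sym)
qed (use assms in \<open>auto intro: L2_norm_sq_peter_paul L2_norm_sq_nonneg\<close>)

section \<open>Weighted norms on the strip\<close>

text \<open>The conditions are confined to the strip because a ruled weight may vanish outside it.
  Inside, the class is closed under \<open>1 / w\<close>, which the longitudinal term
  requires.\<close>

definition weight :: "real \<Rightarrow> (real \<times> real \<Rightarrow> real) \<Rightarrow> bool" where
  "weight a w \<longleftrightarrow> continuous_on (strip a) w \<and> (\<forall>p\<in>strip a. 0 < w p)"

lemma open_strip: "open (strip a)"
  unfolding strip_def by (intro open_Times) auto

lemma borel_measurable_strip_measure:
  "borel_measurable (strip_measure a w) = borel_measurable (restrict_space lborel (strip a))"
  by (intro measurable_cong_sets) (auto simp: strip_measure_def)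

lemma weight_measurable:
  assumes "weight a w"
  shows "w \<in> borel_measurable (restrict_space lborel (strip a))"
proof -
  have "w \<in> borel_measurable (restrict_space borel (strip a))"
    using assms by (intro borel_measurable_continuous_on_restrict) (simp add: weight_def)
  moreover have "borel_measurable (restrict_space borel (strip a))
      = (borel_measurable (restrict_space lborel (strip a)) :: (real \<times> real \<Rightarrow> real) set)"
    by (intro measurable_cong_sets sets_restrict_space_cong) auto
  ultimately show ?thesis
    by simp
qed

lemma space_restrict_strip [simp]: "space (restrict_space lborel (strip a)) = strip a"
  by (simp add: space_restrict_space)

lemma weight_one: "weight a (\<lambda>_. 1)"
  by (simp add: weight_def)

lemma weight_inverse:
  "weight a w \<Longrightarrow> weight a (\<lambda>p. 1 / w p)"
  unfolding weight_def by (auto intro!: continuous_intros) 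

lemma integral_strip_measure:
  fixes f :: "real \<times> real \<Rightarrow> 'b::{banach, second_countable_topology}"
  assumes w: "weight a w" and f: "f \<in> borel_measurable (restrict_space lborel (strip a))"
  shows "integral\<^sup>L (strip_measure a w) f = (LINT p|restrict_space lborel (strip a). w p *\<^sub>R f p)"
    and "integrable (strip_measure a w) f \<longleftrightarrow>
      integrable (restrict_space lborel (strip a)) (\<lambda>p. w p *\<^sub>R f p)"
proof -
  have "AE p in restrict_space lborel (strip a). 0 \<le> w p"
    using w by (intro AE_I2) (auto simp: weight_def intro: less_imp_le)
  then show "integral\<^sup>L (strip_measure a w) f = (LINT p|restrict_space lborel (strip a). w p *\<^sub>R f p)"
    and "integrable (strip_measure a w) f \<longleftrightarrow>
      integrable (restrict_space lborel (strip a)) (\<lambda>p. w p *\<^sub>R f p)"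
    unfolding strip_measure_def
    using f weight_measurable[OF w] by (simp_all add: integral_density integrable_density)
qed

lemma L2_functions_strip_measure:
  assumes "weight a w"
  shows "f \<in> L2_functions (strip_measure a w) \<longleftrightarrow>
    f \<in> borel_measurable (restrict_space lborel (strip a)) \<and>
    integrable (restrict_space lborel (strip a)) (\<lambda>p. w p * (cmod (f p))\<^sup>2)"
  using integral_strip_measure(2)[OF assms, of "\<lambda>p. (cmod (f p))\<^sup>2"]
  by (auto simp: L2_functions_def borel_measurable_strip_measure)

lemma L2_norm_sq_strip_measure:
  assumes "weight a w" "f \<in> borel_measurable (restrict_space lborel (strip a))"
  shows "L2_norm_sq (strip_measure a w) f
    = (LINT p|restrict_space lborel (strip a). w p * (cmod (f p))\<^sup>2)"
  unfolding L2_norm_sq_def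
  using assms by (subst integral_strip_measure) auto

lemma L2_strip_measure_mono:
  assumes w: "weight a w" and v: "weight a v"
    and le: "\<And>p. p \<in> strip a \<Longrightarrow> w p \<le> L * v p"
    and f: "f \<in> L2_functions (strip_measure a v)"
  shows "f \<in> L2_functions (strip_measure a w)"
    and "L2_norm_sq (strip_measure a w) f \<le> L * L2_norm_sq (strip_measure a v) f"
proof -
  let ?R = "restrict_space lborel (strip a)"
  have m [measurable]: "f \<in> borel_measurable ?R" and "integrable ?R (\<lambda>p. v p * (cmod (f p))\<^sup>2)"
    using f by (auto simp: L2_functions_strip_measure[OF v])
  then have i: "integrable ?R (\<lambda>p. L * (v p * (cmod (f p))\<^sup>2))"
    by simp
  note [measurable] = weight_measurable[OF w]
  have le': "w p * (cmod (f p))\<^sup>2 \<le> L * (v p * (cmod (f p))\<^sup>2)" if "p \<in> strip a" for p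
    using mult_right_mono[OF le[OF that], of "(cmod (f p))\<^sup>2"] by (simp add: mult.assoc)
  have i': "integrable ?R (\<lambda>p. w p * (cmod (f p))\<^sup>2)"
  proof (rule Bochner_Integration.integrable_bound[OF i])
    show "AE p in ?R. norm (w p * (cmod (f p))\<^sup>2) \<le> norm (L * (v p * (cmod (f p))\<^sup>2))"
    proof (intro AE_I2)
      fix p assume "p \<in> space ?R"
      then have p: "p \<in> strip a" by simp
      then have "0 \<le> w p * (cmod (f p))\<^sup>2"
        using w by (simp add: weight_def less_imp_le)
      then show "norm (w p * (cmod (f p))\<^sup>2) \<le> norm (L * (v p * (cmod (f p))\<^sup>2))"
        using le'[OF p] by simp
    qed
  qed measurable
  then show "f \<in> L2_functions (strip_measure a w)"
    using m by (simp add: L2_functions_strip_measure[OF w])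
  have "(LINT p|?R. w p * (cmod (f p))\<^sup>2) \<le> (LINT p|?R. L * (v p * (cmod (f p))\<^sup>2))"
    using i' i by (rule integral_mono) (simp add: le')
  then show "L2_norm_sq (strip_measure a w) f \<le> L * L2_norm_sq (strip_measure a v) f"
    by (simp add: L2_norm_sq_strip_measure w v m)
qed

lemma divide_weight_measurable:
  assumes "weight a h" "g \<in> borel_measurable (restrict_space lborel (strip a))"
  shows "(\<lambda>p. g p / complex_of_real (h p)) \<in> borel_measurable (restrict_space lborel (strip a))"
  using assms(2) weight_measurable[OF assms(1)] by measurable

text \<open>The volume element absorbs one of the two factors \<open>1 / h\<close>, since h |g1 /
  h|^2 = |g1|^2 / h. The energy thus becomes a sum of two weighted norms, and comparing energies
  reduces to comparing \<open>h\<close> and \<open>1 / h\<close>.\<close>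

lemma energy_eq_weighted_norms:
  assumes h: "weight a h" and g1: "g1 \<in> borel_measurable (restrict_space lborel (strip a))"
  shows "energy a h g1 g2
    = L2_norm_sq (strip_measure a (\<lambda>p. 1 / h p)) g1 + L2_norm_sq (strip_measure a h) g2"
proof -
  have "(LINT p|restrict_space lborel (strip a). h p * (cmod (g1 p / complex_of_real (h p)))\<^sup>2)
      = (LINT p|restrict_space lborel (strip a). 1 / h p * (cmod (g1 p))\<^sup>2)"
    using h by (intro Bochner_Integration.integral_cong)
      (auto simp: norm_divide power_divide weight_def power2_eq_square)
  then show ?thesis
    unfolding energy_def
    using h g1 weight_inverse[OF h] divide_weight_measurable[OF h g1]
    by (simp add: L2_norm_sq_strip_measure)
qed

section \<open>The energy as the square of a seminorm\<close>

definition finite_energy ::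
  "real \<Rightarrow> (real \<times> real \<Rightarrow> real) \<Rightarrow> (real \<times> real \<Rightarrow> complex) \<Rightarrow> (real \<times> real \<Rightarrow> complex) \<Rightarrow> bool"
where
  "finite_energy a h g1 g2 \<longleftrightarrow>
     g1 \<in> L2_functions (strip_measure a (\<lambda>p. 1 / h p)) \<and> g2 \<in> L2_functions (strip_measure a h)"

lemma finite_energy_measurable:
  assumes "finite_energy a h g1 g2"
  shows "g1 \<in> borel_measurable (restrict_space lborel (strip a))"
  using assms by (auto simp: finite_energy_def L2_functions_def borel_measurable_strip_measure)

lemma energy_nonneg: "0 \<le> energy a h g1 g2"
  unfolding energy_def by (simp add: L2_norm_sq_nonneg)

lemma finite_energy_diff:
  assumes "finite_energy a h g1 g2" "finite_energy a h k1 k2"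
  shows "finite_energy a h (\<lambda>p. g1 p - k1 p) (\<lambda>p. g2 p - k2 p)"
  using assms by (simp add: finite_energy_def L2_functions_diff)

lemma energy_diff_le:
  assumes h: "weight a h" and g: "finite_energy a h g1 g2" and k: "finite_energy a h k1 k2"
  shows "energy a h (\<lambda>p. g1 p - k1 p) (\<lambda>p. g2 p - k2 p)
    \<le> 2 * energy a h g1 g2 + 2 * energy a h k1 k2"
proof -
  have "g1 \<in> L2_functions (strip_measure a (\<lambda>p. 1 / h p))" "k1 \<in> L2_functions (strip_measure a (\<lambda>p. 1 / h p))"
    and "g2 \<in> L2_functions (strip_measure a h)" "k2 \<in> L2_functions (strip_measure a h)"
    using g k by (auto simp: finite_energy_def)
  then show ?thesis
    using L2_norm_sq_diff_le[of g1 _ k1] L2_norm_sq_diff_le[of g2 _ k2]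
      finite_energy_measurable[OF finite_energy_diff[OF g k]]
    by (fastforce simp: energy_eq_weighted_norms[OF h] finite_energy_measurable[OF g]
        finite_energy_measurable[OF k])
qed

lemma energy_peter_paul:
  assumes h: "weight a h" and g: "finite_energy a h g1 g2" and k: "finite_energy a h k1 k2"
    and "\<eta> > 0"
  shows "energy a h g1 g2 \<le> (1 + \<eta>) * energy a h k1 k2
    + (1 + 1 / \<eta>) * energy a h (\<lambda>p. g1 p - k1 p) (\<lambda>p. g2 p - k2 p)"
proof -
  have "g1 \<in> L2_functions (strip_measure a (\<lambda>p. 1 / h p))" "k1 \<in> L2_functions (strip_measure a (\<lambda>p. 1 / h p))"
    and "g2 \<in> L2_functions (strip_measure a h)" "k2 \<in> L2_functions (strip_measure a h)"
    using g k by (auto simp: finite_energy_def)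
  from add_mono[OF L2_norm_sq_peter_paul[OF \<open>g1 \<in> _\<close> \<open>k1 \<in> _\<close> assms(4)]
      L2_norm_sq_peter_paul[OF \<open>g2 \<in> _\<close> \<open>k2 \<in> _\<close> assms(4)]]
  show ?thesis
    using finite_energy_measurable[OF finite_energy_diff[OF g k]]
    by (simp add: energy_eq_weighted_norms[OF h] finite_energy_measurable[OF g]
      finite_energy_measurable[OF k] distrib_left)
qed

lemma energy_minus_commute:
  "energy a h (\<lambda>p. g1 p - k1 p) (\<lambda>p. g2 p - k2 p) = energy a h (\<lambda>p. k1 p - g1 p) (\<lambda>p. k2 p - g2 p)"
  by (simp add: energy_def L2_norm_sq_def norm_divide norm_minus_commute)

lemma energy_sqrt_dist:
  assumes h: "weight a h" and g: "finite_energy a h g1 g2" and k: "finite_energy a h k1 k2"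
  shows "\<bar>sqrt (energy a h g1 g2) - sqrt (energy a h k1 k2)\<bar>
    \<le> sqrt (energy a h (\<lambda>p. g1 p - k1 p) (\<lambda>p. g2 p - k2 p))"
proof (rule sqrt_dist_of_peter_paul)
  show "energy a h k1 k2 \<le> (1 + \<eta>) * energy a h g1 g2
      + (1 + 1 / \<eta>) * energy a h (\<lambda>p. g1 p - k1 p) (\<lambda>p. g2 p - k2 p)" if "\<eta> > 0" for \<eta>
    using energy_peter_paul[OF h k g that] by (simp only: energy_minus_commute[of a h k1 g1 k2 g2])
qed (auto intro: energy_peter_paul[OF h g k] energy_nonneg)

section \<open>Compactly supported functions\<close>

text \<open>Continuity is demanded on \<open>S\<close> only, so that products of test functions with
  \<open>1 / h\<close> qualify even if \<open>h\<close> has zeros outside the strip. Vanishing off a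
  compact subset of \<open>S\<close> still gives integrability over the whole space.\<close>

definition compactly_supported_in ::
  "('a::topological_space) set \<Rightarrow> ('a \<Rightarrow> 'b::real_normed_vector) \<Rightarrow> bool" where
  "compactly_supported_in S f \<longleftrightarrow>
     continuous_on S f \<and> (\<exists>K. compact K \<and> K \<subseteq> S \<and> (\<forall>p. p \<notin> K \<longrightarrow> f p = 0))"

lemma compactly_supported_in_comp:
  assumes "compactly_supported_in S f" "continuous_on S g" "\<And>p. f p = 0 \<Longrightarrow> g p = 0"
  shows "compactly_supported_in S g"
  using assms unfolding compactly_supported_in_def by metis

lemma compactly_supported_in_continuous:
  "compactly_supported_in S f \<Longrightarrow> continuous_on S f"
  by (simp add: compactly_supported_in_def)

lemma compactly_supported_in_outside:
  "compactly_supported_in S f \<Longrightarrow> p \<notin> S \<Longrightarrow> f p = 0"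
  by (auto simp: compactly_supported_in_def)

lemma compactly_supported_in_integrable:
  fixes f :: "'a::euclidean_space \<Rightarrow> 'b::{banach, second_countable_topology}"
  assumes "compactly_supported_in S f"
  shows "integrable lborel f"
proof -
  obtain K where K: "compact K" "K \<subseteq> S" "\<And>p. p \<notin> K \<Longrightarrow> f p = 0" and f: "continuous_on S f"
    using assms unfolding compactly_supported_in_def by blast
  have "integrable lborel (\<lambda>p. indicator K p *\<^sub>R f p)"
    using K(1) continuous_on_subset[OF f K(2)] by (rule borel_integrable_compact)
  also have "(\<lambda>p. indicator K p *\<^sub>R f p) = f"
    using K(3) by (auto simp: indicator_def)
  finally show ?thesis .
qed

lemma compactly_supported_in_measurable:
  fixes f :: "real \<times> real \<Rightarrow> 'b::{banach, second_countable_topology}"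
  assumes "compactly_supported_in S f"
  shows "f \<in> borel_measurable (restrict_space lborel A)"
  using borel_measurable_integrable[OF compactly_supported_in_integrable[OF assms]]
  by (rule measurable_restrict_space1)

text \<open>Moves integrals from the strip to the whole plane, where Fubini and integration by parts
  involve no boundary.\<close>

lemma integral_strip_measure_compactly_supported:
  fixes f :: "real \<times> real \<Rightarrow> 'b::{banach, second_countable_topology}"
  assumes w: "weight a w" and f: "compactly_supported_in (strip a) f"
  shows "integral\<^sup>L (strip_measure a w) f = (LINT p|lborel. w p *\<^sub>R f p)"
    and "integrable (strip_measure a w) f"
proof -
  have eq: "indicator (strip a) p *\<^sub>R w p *\<^sub>R f p = w p *\<^sub>R f p" for p
    using compactly_supported_in_outside[OF f, of p] by (cases "p \<in> strip a") auto
  have cs: "compactly_supported_in (strip a) (\<lambda>p. w p *\<^sub>R f p)"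
    using w by (intro compactly_supported_in_comp[OF f] continuous_intros
        compactly_supported_in_continuous[OF f]) (auto simp: weight_def)
  have S: "strip a \<inter> space lborel \<in> sets lborel"
    using open_strip by simp
  show "integral\<^sup>L (strip_measure a w) f = (LINT p|lborel. w p *\<^sub>R f p)"
    using integral_strip_measure(1)[OF w compactly_supported_in_measurable[OF f]]
    by (simp only: integral_restrict_space[OF S] eq)
  show "integrable (strip_measure a w) f"
    using integral_strip_measure(2)[OF w compactly_supported_in_measurable[OF f]]
      compactly_supported_in_integrable[OF cs]
    by (simp only: integrable_restrict_space[OF S] eq)
qed

lemma compactly_supported_in_cmod_sq:
  fixes f :: "'a::topological_space \<Rightarrow> complex"
  assumes "compactly_supported_in S f"
  shows "compactly_supported_in S (\<lambda>p. (cmod (f p))\<^sup>2)"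
  by (intro compactly_supported_in_comp[OF assms] continuous_intros
      compactly_supported_in_continuous[OF assms]) auto

lemma compactly_supported_in_weighted:
  fixes f :: "real \<times> real \<Rightarrow> complex"
  assumes "weight a w" "compactly_supported_in (strip a) f"
  shows "compactly_supported_in (strip a) (\<lambda>p. w p * (cmod (f p))\<^sup>2)"
  using assms(1) by (intro compactly_supported_in_comp[OF assms(2)] continuous_intros
      compactly_supported_in_continuous[OF assms(2)]) (auto simp: weight_def)

lemma compactly_supported_in_L2:
  assumes w: "weight a w" and f: "compactly_supported_in (strip a) f"
  shows "f \<in> L2_functions (strip_measure a w)"
    and "L2_norm_sq (strip_measure a w) f = (LINT p|lborel. w p * (cmod (f p))\<^sup>2)"
  using integral_strip_measure_compactly_supported[OF w compactly_supported_in_cmod_sq[OF f]]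
    compactly_supported_in_measurable[OF f]
  by (simp_all add: L2_functions_def L2_norm_sq_def borel_measurable_strip_measure)

section \<open>Test functions\<close>

lemma C_k_diff:
  assumes "C_k k f" "C_k k g"
  shows "C_k k (\<lambda>p. f p - g p)"
  using assms
proof (induction k arbitrary: f g)
  case 0
  then show ?case
    by (auto intro: continuous_on_diff)
next
  case (Suc k)
  have "partial1 (\<lambda>p. f p - g p) = (\<lambda>p. partial1 f p - partial1 g p)"
    and "partial2 (\<lambda>p. f p - g p) = (\<lambda>p. partial2 f p - partial2 g p)"
    using Suc.prems by (auto simp: partial1_def partial2_def fun_eq_iff vector_derivative_diff_at)
  then show ?case
    using Suc by (auto intro: continuous_on_diff differentiable_diff)
qed

lemma test_functions_C_k: "\<phi> \<in> test_functions a \<Longrightarrow> C_k k \<phi>"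
  by (simp add: test_functions_def)

lemma test_functions_continuous: "\<phi> \<in> test_functions a \<Longrightarrow> continuous_on A \<phi>"
  using test_functions_C_k[of \<phi> a 0] continuous_on_subset by auto

lemma test_functions_partial_derivatives:
  assumes "\<phi> \<in> test_functions a"
  shows "((\<lambda>x. \<phi> (x, t)) has_vector_derivative partial1 \<phi> (s, t)) (at s)"
    and "((\<lambda>y. \<phi> (s, y)) has_vector_derivative partial2 \<phi> (s, t)) (at t)"
  using test_functions_C_k[OF assms, of 1]
  by (auto simp: partial1_def partial2_def vector_derivative_works)

lemma partial_diff:
  assumes "\<phi> \<in> test_functions a" "\<psi> \<in> test_functions a"
  shows "partial1 (\<lambda>p. \<phi> p - \<psi> p) = (\<lambda>p. partial1 \<phi> p - partial1 \<psi> p)"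
    and "partial2 (\<lambda>p. \<phi> p - \<psi> p) = (\<lambda>p. partial2 \<phi> p - partial2 \<psi> p)"
  using test_functions_C_k[OF assms(1), of 1] test_functions_C_k[OF assms(2), of 1]
  by (auto simp: partial1_def partial2_def fun_eq_iff vector_derivative_diff_at)

lemma test_functions_compactly_supported:
  assumes "\<phi> \<in> test_functions a"
  shows "compactly_supported_in (strip a) \<phi>"
  unfolding compactly_supported_in_def
proof (intro conjI exI)
  show "\<forall>p. p \<notin> closure {p. \<phi> p \<noteq> 0} \<longrightarrow> \<phi> p = 0"
    using closure_subset[of "{p. \<phi> p \<noteq> 0}"] by auto
qed (use assms test_functions_continuous in \<open>auto simp: test_functions_def\<close>)

lemma compact_closure_subset:
  assumes "compact (closure A)" "closure A \<subseteq> S" "B \<subseteq> closure A"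
  shows "compact (closure B)" "closure B \<subseteq> S"
proof -
  have "closure B \<subseteq> closure A"
    using assms(3) by (simp add: closure_minimal)
  then show "compact (closure B)" "closure B \<subseteq> S"
    using assms compact_Int_closed[of "closure A" "closure B"] by (auto simp: Int_absorb1)
qed

lemma test_functions_diff:
  assumes "\<phi> \<in> test_functions a" "\<psi> \<in> test_functions a"
  shows "(\<lambda>p. \<phi> p - \<psi> p) \<in> test_functions a"
proof -
  let ?A = "{p. \<phi> p \<noteq> 0} \<union> {p. \<psi> p \<noteq> 0}"
  have "compact (closure ?A)" "closure ?A \<subseteq> strip a"
    using assms by (auto simp: test_functions_def)
  moreover have "{p. \<phi> p - \<psi> p \<noteq> 0} \<subseteq> closure ?A"
    by (rule order.trans[OF _ closure_subset]) auto
  ultimately have "compact (closure {p. \<phi> p - \<psi> p \<noteq> 0})" "closure {p. \<phi> p - \<psi> p \<noteq> 0} \<subseteq> strip a"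
    by (rule compact_closure_subset)+
  then show ?thesis
    using assms by (auto simp: test_functions_def intro: C_k_diff)
qed

section \<open>Supports of derivatives\<close>

lemma has_vector_derivative_0_of_open:
  fixes g :: "real \<Rightarrow> 'b::real_normed_vector"
  assumes "open U" "x \<in> U" "\<And>y. y \<in> U \<Longrightarrow> g y = 0"
  shows "(g has_vector_derivative 0) (at x)"
  using has_vector_derivative_transform_within_open[of "\<lambda>_. 0" 0 x U g] assms by simp

lemma partial1_support: "{p. partial1 f p \<noteq> 0} \<subseteq> closure {p. f p \<noteq> 0}"
proof clarify
  fix s t assume nz: "partial1 f (s, t) \<noteq> 0"
  show "(s, t) \<in> closure {p. f p \<noteq> 0}"
  proof (rule ccontr)
    assume out: "(s, t) \<notin> closure {p. f p \<noteq> 0}"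
    let ?U = "(\<lambda>x. (x, t)) -` (- closure {p. f p \<noteq> 0})"
    have "((\<lambda>x. f (x, t)) has_vector_derivative 0) (at s)"
    proof (rule has_vector_derivative_0_of_open)
      show "open ?U"
        by (intro open_vimage continuous_intros) auto
      show "s \<in> ?U"
        using out by simp
      show "f (x, t) = 0" if "x \<in> ?U" for x
        using that closure_subset[of "{p. f p \<noteq> 0}"] by auto
    qed
    then show False
      using nz by (simp add: partial1_def vector_derivative_at)
  qed
qed

lemma partial2_support: "{p. partial2 f p \<noteq> 0} \<subseteq> closure {p. f p \<noteq> 0}"
proof clarify
  fix s t assume nz: "partial2 f (s, t) \<noteq> 0"
  show "(s, t) \<in> closure {p. f p \<noteq> 0}"
  proof (rule ccontr)
    assume out: "(s, t) \<notin> closure {p. f p \<noteq> 0}"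
    let ?U = "Pair s -` (- closure {p. f p \<noteq> 0})"
    have "((\<lambda>x. f (s, x)) has_vector_derivative 0) (at t)"
    proof (rule has_vector_derivative_0_of_open)
      show "open ?U"
        by (intro open_vimage continuous_intros) auto
      show "t \<in> ?U"
        using out by simp
      show "f (s, x) = 0" if "x \<in> ?U" for x
        using that closure_subset[of "{p. f p \<noteq> 0}"] by auto
    qed
    then show False
      using nz by (simp add: partial2_def vector_derivative_at)
  qed
qed

text \<open>Stability under differentiation makes the Laplacian of a test function available, which
  is what closability rests on.\<close>

lemma test_functions_partial:
  assumes "\<phi> \<in> test_functions a"
  shows "partial1 \<phi> \<in> test_functions a" "partial2 \<phi> \<in> test_functions a"
proof -
  have "C_k k (partial1 \<phi>)" "C_k k (partial2 \<phi>)" for k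
    using test_functions_C_k[OF assms, of "Suc k"] by auto
  then show "partial1 \<phi> \<in> test_functions a" "partial2 \<phi> \<in> test_functions a"
    using assms compact_closure_subset[OF _ _ partial1_support[of \<phi>]]
      compact_closure_subset[OF _ _ partial2_support[of \<phi>]]
    unfolding test_functions_def by blast+
qed

lemma test_functions_finite_energy:
  assumes "weight a h" "\<phi> \<in> test_functions a"
  shows "finite_energy a h (partial1 \<phi>) (partial2 \<phi>)"
  unfolding finite_energy_def
  using assms by (auto intro!: compactly_supported_in_L2(1) weight_inverse
      test_functions_compactly_supported test_functions_partial)

lemma test_functions_energy:
  assumes "weight a h" "\<phi> \<in> test_functions a"
  shows "energy a h (partial1 \<phi>) (partial2 \<phi>)
    = (LINT p|lborel. 1 / h p * (cmod (partial1 \<phi> p))\<^sup>2) + (LINT p|lborel. h p * (cmod (partial2 \<phi> p))\<^sup>2)"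
  using test_functions_partial[OF assms(2), THEN test_functions_compactly_supported]
  by (simp add: energy_eq_weighted_norms[OF assms(1)] compactly_supported_in_measurable
      compactly_supported_in_L2(2) assms(1) weight_inverse)

lemma test_functions_support_box:
  assumes "\<phi> \<in> test_functions a" "a > 0"
  obtains R b where "0 < b" "b < a" "\<And>s t. \<bar>s\<bar> > R \<or> \<bar>t\<bar> > b \<Longrightarrow> \<phi> (s, t) = 0"
proof -
  obtain K where K: "compact K" "K \<subseteq> strip a" "\<And>p. p \<notin> K \<Longrightarrow> \<phi> p = 0"
    using test_functions_compactly_supported[OF assms(1)] unfolding compactly_supported_in_def by blast
  \<comment> \<open>Adjoining the origin makes the compact set nonempty, so
    \<open>\<bar>snd p\<bar>\<close> attains a maximum; the added point cannot spoil the strict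
    bound by \<open>a\<close>.\<close>
  have cK: "compact (insert (0, 0) K)"
    using K(1) by simp
  obtain R where R: "\<And>p. p \<in> K \<Longrightarrow> norm p \<le> R"
    using compact_imp_bounded[OF K(1)] unfolding bounded_iff by blast
  have "\<exists>p0\<in>insert (0, 0) K. \<forall>p\<in>insert (0, 0) K. \<bar>snd p\<bar> \<le> \<bar>snd p0\<bar>"
    by (intro continuous_attains_sup cK continuous_intros) auto
  then obtain p0 where p0: "p0 \<in> insert (0, 0) K" "\<And>p. p \<in> K \<Longrightarrow> \<bar>snd p\<bar> \<le> \<bar>snd p0\<bar>"
    by blast
  have "\<bar>snd p0\<bar> < a"
    using p0(1) subsetD[OF K(2), of p0] assms(2) by (cases p0) (auto simp: strip_def)
  then obtain b where b: "\<bar>snd p0\<bar> < b" "b < a"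
    using dense by blast
  show thesis
  proof
    show "0 < b" "b < a"
      using b by auto
    show "\<phi> (s, t) = 0" if "\<bar>s\<bar> > R \<or> \<bar>t\<bar> > b" for s t
      using that R[of "(s, t)"] norm_fst_le[of s t] p0(2)[of "(s, t)"] b K(3)[of "(s, t)"]
      by (cases "(s, t) \<in> K") auto
  qed
qed

section \<open>Integration by parts on the plane\<close>

lemma integral_derivative_eq_0:
  fixes g :: "real \<Rightarrow> 'b::euclidean_space"
  assumes d: "\<And>x. (g has_vector_derivative g' x) (at x)"
    and 0: "\<And>x. \<bar>x\<bar> > R \<Longrightarrow> g x = 0" and c: "continuous_on UNIV g'"
  shows "(LINT x|lborel. g' x) = 0"
proof -
  \<comment> \<open>The interval from \<open>-S\<close> to \<open>S\<close> is nondegenerate even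
    for negative \<open>R\<close>, and its endpoints lie strictly beyond \<open>R\<close>, where
    \<open>g\<close> vanishes.\<close>
  define S where "S = max R 0 + 1"
  have g'0: "g' x = 0" if "\<bar>x\<bar> > R" for x
  proof -
    have op: "open {x. \<bar>x\<bar> > R}"
      by (intro open_Collect_less continuous_intros)
    have "(g has_vector_derivative 0) (at x)"
      by (rule has_vector_derivative_0_of_open[OF op]) (use that 0 in auto)
    with d[of x] show ?thesis
      by (metis vector_derivative_at)
  qed
  have "compactly_supported_in UNIV g'"
    unfolding compactly_supported_in_def
    by (intro conjI exI[of _ "{-S..S}"] c) (auto simp: S_def intro!: g'0)
  then have i: "integrable lborel g'"
    by (rule compactly_supported_in_integrable)
  have "(g' has_integral (g S - g (-S))) {-S..S}"
    using d by (intro fundamental_theorem_of_calculus[of "-S" S g g'])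
      (auto simp: S_def intro: has_vector_derivative_at_within)
  moreover have "g S = 0" "g (-S) = 0"
    by (auto simp: S_def intro!: 0)
  ultimately have "(g' has_integral 0) {-S..S}"
    by simp
  then have "(g' has_integral 0) UNIV"
    by (rule has_integral_on_superset) (auto simp: S_def intro!: g'0)
  then show ?thesis
    using has_integral_integral_lborel[OF i] has_integral_unique by blast
qed

lemma lborel_prod_integral:
  fixes f :: "real \<times> real \<Rightarrow> 'b::{banach, second_countable_topology}"
  assumes "integrable lborel f"
  shows "(LINT p|lborel. f p) = (LINT s|lborel. LINT t|lborel. f (s, t))"
    and "(LINT p|lborel. f p) = (LINT t|lborel. LINT s|lborel. f (s, t))"
proof -
  have i: "integrable (lborel \<Otimes>\<^sub>M lborel) f" "integrable (lborel \<Otimes>\<^sub>M lborel) (\<lambda>(s, t). f (s, t))"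
    using assms by (simp_all add: lborel_prod)
  show "(LINT p|lborel. f p) = (LINT s|lborel. LINT t|lborel. f (s, t))"
    using lborel_pair.integral_fst'[OF i(1)] by (simp add: lborel_prod)
  show "(LINT p|lborel. f p) = (LINT t|lborel. LINT s|lborel. f (s, t))"
    using lborel_pair.integral_snd[of "\<lambda>s t. f (s, t)", OF i(2)] by (simp add: lborel_prod)
qed

text \<open>Stated for a bilinear map because two products occur: complex multiplication for weak
  gradients and the real inner product for the Laplacian. By the Leibniz rule the two integrands add
  up to a derivative of the compactly supported \<open>B (f p) (g p)\<close>, and Fubini is used
  with the differentiated variable innermost.\<close>

lemma test_functions_integration_by_parts:
  fixes B :: "complex \<Rightarrow> complex \<Rightarrow> 'b::euclidean_space"
  assumes B: "bounded_bilinear B" and f: "f \<in> test_functions a" and g: "g \<in> test_functions a" and "a > 0"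
  shows "(LINT p|lborel. B (f p) (partial1 g p)) = - (LINT p|lborel. B (partial1 f p) (g p))"
    and "(LINT p|lborel. B (f p) (partial2 g p)) = - (LINT p|lborel. B (partial2 f p) (g p))"
proof -
  interpret bounded_bilinear B by (rule B)
  have cs: "compactly_supported_in UNIV (\<lambda>p. B (u p) (v p))"
    if u: "u \<in> test_functions a" and v: "v \<in> test_functions a" for u v
  proof (rule compactly_supported_in_comp[of UNIV u])
    show "compactly_supported_in UNIV u"
      using test_functions_compactly_supported[OF u] test_functions_continuous[OF u]
      by (auto simp: compactly_supported_in_def)
  qed (auto intro!: continuous_on test_functions_continuous[OF u] test_functions_continuous[OF v] zero_left)
  note int = cs[THEN compactly_supported_in_integrable]
  note cont = cs[THEN compactly_supported_in_continuous]
  obtain R b where b: "b < a" and Rb: "\<And>s t. \<bar>s\<bar> > R \<or> \<bar>t\<bar> > b \<Longrightarrow> f (s, t) = 0"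
    using test_functions_support_box[OF f \<open>a > 0\<close>] by metis
  note f' = test_functions_partial[OF f] and g' = test_functions_partial[OF g]
  let ?D1 = "\<lambda>p. B (f p) (partial1 g p) + B (partial1 f p) (g p)"
  let ?D2 = "\<lambda>p. B (f p) (partial2 g p) + B (partial2 f p) (g p)"
  have "(LINT s|lborel. ?D1 (s, t)) = 0" for t
  proof (rule integral_derivative_eq_0[where R = R])
    show "((\<lambda>s. B (f (s, t)) (g (s, t))) has_vector_derivative ?D1 (s, t)) (at s)" for s
      by (rule has_vector_derivative[OF test_functions_partial_derivatives(1)[OF f]
            test_functions_partial_derivatives(1)[OF g]])
    show "continuous_on UNIV (\<lambda>s. ?D1 (s, t))"
      by (intro continuous_on_add continuous_on_compose2[OF cont[OF f g'(1)]]
          continuous_on_compose2[OF cont[OF f'(1) g]] continuous_intros) auto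
  qed (auto simp: Rb zero_left)
  then have "(LINT p|lborel. ?D1 p) = 0"
    by (subst lborel_prod_integral(2)) (auto intro!: Bochner_Integration.integrable_add int f g f' g')
  then show "(LINT p|lborel. B (f p) (partial1 g p)) = - (LINT p|lborel. B (partial1 f p) (g p))"
    by (simp add: Bochner_Integration.integral_add int f g f' g' eq_neg_iff_add_eq_0)
  have "(LINT t|lborel. ?D2 (s, t)) = 0" for s
  proof (rule integral_derivative_eq_0[where R = b])
    show "((\<lambda>t. B (f (s, t)) (g (s, t))) has_vector_derivative ?D2 (s, t)) (at t)" for t
      by (rule has_vector_derivative[OF test_functions_partial_derivatives(2)[OF f]
            test_functions_partial_derivatives(2)[OF g]])
    show "continuous_on UNIV (\<lambda>t. ?D2 (s, t))"
      by (intro continuous_on_add continuous_on_compose2[OF cont[OF f g'(2)]]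
          continuous_on_compose2[OF cont[OF f'(2) g]] continuous_intros) auto
  qed (auto simp: Rb zero_left)
  then have "(LINT p|lborel. ?D2 p) = 0"
    by (subst lborel_prod_integral(1)) (auto intro!: Bochner_Integration.integrable_add int f g f' g')
  then show "(LINT p|lborel. B (f p) (partial2 g p)) = - (LINT p|lborel. B (partial2 f p) (g p))"
    by (simp add: Bochner_Integration.integral_add int f g f' g' eq_neg_iff_add_eq_0)
qed

section \<open>Closability of the Dirichlet form\<close>

lemma test_functions_L2:
  assumes "weight a w" "\<phi> \<in> test_functions a"
  shows "\<phi> \<in> L2_functions (strip_measure a w)"
    and "L2_norm_sq (strip_measure a w) \<phi> = (LINT p|lborel. w p * (cmod (\<phi> p))\<^sup>2)"
  using assms by (auto intro: compactly_supported_in_L2 test_functions_compactly_supported)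

lemma test_functions_weighted_integrable:
  assumes "weight a w" "\<phi> \<in> test_functions a"
  shows "integrable lborel (\<lambda>p. w p * (cmod (\<phi> p))\<^sup>2)"
  using assms by (intro compactly_supported_in_integrable[of "strip a"] compactly_supported_in_weighted
      test_functions_compactly_supported)

lemma test_functions_weak_gradient:
  assumes "a > 0" "\<phi> \<in> test_functions a"
  shows "has_weak_gradient a \<phi> (partial1 \<phi>) (partial2 \<phi>)"
proof -
  have cs: "compactly_supported_in (strip a) (\<lambda>p. f p * g p)"
    if "f \<in> test_functions a" "g \<in> test_functions a" for f g :: "real \<times> real \<Rightarrow> complex"
    using that by (intro compactly_supported_in_comp[OF test_functions_compactly_supported[OF that(1)]]
        continuous_intros test_functions_continuous) auto
  note flat = integral_strip_measure_compactly_supported(1)[OF weight_one cs]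
  show ?thesis
    unfolding has_weak_gradient_def
    using assms test_functions_partial[OF assms(2)]
    by (auto simp: flat test_functions_partial intro!: test_functions_L2(1) weight_one
        test_functions_integration_by_parts[OF bounded_bilinear_mult])
qed

text \<open>Lets the hypothesis \<open>Hardy_pair\<close>, which speaks of \<open>W12_0\<close>, be
  applied to test functions.\<close>

lemma test_functions_subset_W12_0:
  assumes "a > 0" "\<phi> \<in> test_functions a"
  shows "\<phi> \<in> W12_0 a"
proof -
  have "(\<lambda>n::nat. L2_norm_sq (strip_lebesgue a) (\<lambda>p. \<phi> p - \<phi> p)
      + L2_norm_sq (strip_lebesgue a) (\<lambda>p. partial1 \<phi> p - partial1 \<phi> p)
      + L2_norm_sq (strip_lebesgue a) (\<lambda>p. partial2 \<phi> p - partial2 \<phi> p)) \<longlonglongrightarrow> 0"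
    by (simp add: L2_norm_sq_def)
  then show ?thesis
    unfolding W12_0_def using test_functions_weak_gradient[OF assms] assms(2)
    by (intro CollectI exI[of _ "partial1 \<phi>"] exI[of _ "partial2 \<phi>"] conjI exI[of _ "\<lambda>_. \<phi>"]) auto
qed

text \<open>Both bounds are required because the two components of the gradient carry reciprocal
  weights.\<close>

lemma energy_comparison:
  assumes h: "weight a h" and k: "weight a k"
    and le: "\<And>p. p \<in> strip a \<Longrightarrow> h p \<le> L * k p" "\<And>p. p \<in> strip a \<Longrightarrow> 1 / h p \<le> L * (1 / k p)"
    and g: "finite_energy a k g1 g2"
  shows "finite_energy a h g1 g2" "energy a h g1 g2 \<le> L * energy a k g1 g2"
proof -
  have g1: "g1 \<in> L2_functions (strip_measure a (\<lambda>p. 1 / k p))" and g2: "g2 \<in> L2_functions (strip_measure a k)"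
    using g by (auto simp: finite_energy_def)
  note 1 = L2_strip_measure_mono[OF weight_inverse[OF h] weight_inverse[OF k] le(2) g1]
  note 2 = L2_strip_measure_mono[OF h k le(1) g2]
  show "finite_energy a h g1 g2"
    using 1 2 by (simp add: finite_energy_def)
  show "energy a h g1 g2 \<le> L * energy a k g1 g2"
    using 1(2) 2(2) by (simp add: energy_eq_weighted_norms h k finite_energy_measurable[OF g] distrib_left)
qed

lemma inner_ge_weighted_squares:
  fixes x y :: "'a::real_inner"
  assumes "\<eta> > 0"
  shows "- 2 * (x \<bullet> y) \<le> \<eta> * (norm x)\<^sup>2 + (norm y)\<^sup>2 / \<eta>"
proof -
  have "0 \<le> (norm (\<eta> *\<^sub>R x + y))\<^sup>2 / \<eta>"
    using assms by simp
  also have "(norm (\<eta> *\<^sub>R x + y))\<^sup>2 = \<eta> * \<eta> * (norm x)\<^sup>2 + 2 * \<eta> * (x \<bullet> y) + (norm y)\<^sup>2"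
    by (simp add: power2_norm_eq_inner inner_add_left inner_add_right inner_commute[of y x] distrib_left)
  also have "\<dots> / \<eta> = \<eta> * (norm x)\<^sup>2 + 2 * (x \<bullet> y) + (norm y)\<^sup>2 / \<eta>"
    using assms by (simp add: add_divide_distrib)
  finally show ?thesis
    by simp
qed

text \<open>Pointwise |x|^2 \<le> |x - y|^2 + 2 (x \<bullet> y). Integration by parts moves every
  derivative in the cross term onto \<open>f\<close>, and Young's inequality separates the Laplacian
  of \<open>f\<close> from \<open>g\<close>. Apart from the energy of the difference,
  \<open>g\<close> then enters only through its norm, with no derivative.\<close>

lemma test_functions_flat_energy_le:
  assumes a: "a > 0" and f: "f \<in> test_functions a" and g: "g \<in> test_functions a" and \<eta>: "\<eta> > 0"
  shows "energy a (\<lambda>_. 1) (partial1 f) (partial2 f)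
    \<le> energy a (\<lambda>_. 1) (\<lambda>p. partial1 f p - partial1 g p) (\<lambda>p. partial2 f p - partial2 g p)
      + \<eta> * (LINT p|lborel. (cmod (partial1 (partial1 f) p + partial2 (partial2 f) p))\<^sup>2)
      + L2_norm_sq (strip_lebesgue a) g / \<eta>"
proof -
  let ?d = "\<lambda>p. f p - g p" and ?\<Delta> = "\<lambda>p. partial1 (partial1 f) p + partial2 (partial2 f) p"
  note d = test_functions_diff[OF f g]
  note f' = test_functions_partial[OF f] and g' = test_functions_partial[OF g]
    and d' = test_functions_partial[OF d, unfolded partial_diff[OF f g]]
  note f'' = test_functions_partial(1)[OF f'(1)] test_functions_partial(2)[OF f'(2)]
  note int1 = test_functions_weighted_integrable[OF weight_one[of a], simplified]
  have int2: "integrable lborel (\<lambda>p. u p \<bullet> v p)"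
    if "u \<in> test_functions a" "v \<in> test_functions a" for u v :: "real \<times> real \<Rightarrow> complex"
    using that by (intro compactly_supported_in_integrable[of "strip a"]
        compactly_supported_in_comp[OF test_functions_compactly_supported[OF that(1)]]
        continuous_intros test_functions_continuous) auto
  have \<Delta>: "integrable lborel (\<lambda>p. (cmod (?\<Delta> p))\<^sup>2)"
  proof -
    have "integrable lborel (\<lambda>p. (cmod (partial1 (partial1 f) p))\<^sup>2 + (cmod (partial2 (partial2 f) p))\<^sup>2
        + 2 * (partial1 (partial1 f) p \<bullet> partial2 (partial2 f) p))"
      by (intro Bochner_Integration.integrable_add integrable_mult_right int1 int2 f'')
    then show ?thesis
      by (simp add: power2_norm_eq_inner inner_add inner_commute algebra_simps)
  qed
  have "(LINT p|lborel. (cmod (partial1 f p))\<^sup>2 + (cmod (partial2 f p))\<^sup>2)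
      \<le> (LINT p|lborel. (cmod (partial1 f p - partial1 g p))\<^sup>2 + (cmod (partial2 f p - partial2 g p))\<^sup>2
          + 2 * (partial1 f p \<bullet> partial1 g p) + 2 * (partial2 f p \<bullet> partial2 g p))"
  proof (rule integral_mono)
    fix p
    have *: "(cmod x)\<^sup>2 \<le> (cmod (x - y))\<^sup>2 + 2 * (x \<bullet> y)" for x y
      by (simp add: power2_norm_eq_inner inner_diff inner_commute)
    show "(cmod (partial1 f p))\<^sup>2 + (cmod (partial2 f p))\<^sup>2
      \<le> (cmod (partial1 f p - partial1 g p))\<^sup>2 + (cmod (partial2 f p - partial2 g p))\<^sup>2
        + 2 * (partial1 f p \<bullet> partial1 g p) + 2 * (partial2 f p \<bullet> partial2 g p)"
      using *[of "partial1 f p" "partial1 g p"] *[of "partial2 f p" "partial2 g p"] by simp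
  qed (intro Bochner_Integration.integrable_add integrable_mult_right int1 int2 f' g' d')+
  also have "\<dots> = (LINT p|lborel. (cmod (partial1 f p - partial1 g p))\<^sup>2)
      + (LINT p|lborel. (cmod (partial2 f p - partial2 g p))\<^sup>2)
      + 2 * (LINT p|lborel. partial1 f p \<bullet> partial1 g p) + 2 * (LINT p|lborel. partial2 f p \<bullet> partial2 g p)"
    by (simp add: int1 int2 f' g' d')
  also have "2 * (LINT p|lborel. partial1 f p \<bullet> partial1 g p) = - 2 * (LINT p|lborel. partial1 (partial1 f) p \<bullet> g p)"
    by (simp add: test_functions_integration_by_parts(1)[OF bounded_bilinear_inner f'(1) g a])
  also have "2 * (LINT p|lborel. partial2 f p \<bullet> partial2 g p) = - 2 * (LINT p|lborel. partial2 (partial2 f) p \<bullet> g p)"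
    by (simp add: test_functions_integration_by_parts(2)[OF bounded_bilinear_inner f'(2) g a])
  also have "(LINT p|lborel. (cmod (partial1 f p - partial1 g p))\<^sup>2)
      + (LINT p|lborel. (cmod (partial2 f p - partial2 g p))\<^sup>2)
      + - 2 * (LINT p|lborel. partial1 (partial1 f) p \<bullet> g p) + - 2 * (LINT p|lborel. partial2 (partial2 f) p \<bullet> g p)
    = energy a (\<lambda>_. 1) (\<lambda>p. partial1 f p - partial1 g p) (\<lambda>p. partial2 f p - partial2 g p)
      + (LINT p|lborel. - 2 * (?\<Delta> p \<bullet> g p))"
    using test_functions_energy[OF weight_one d]
    by (simp add: partial_diff[OF f g] inner_add_left int2 f'' g)
  also have "(LINT p|lborel. - 2 * (?\<Delta> p \<bullet> g p)) \<le> (LINT p|lborel. \<eta> * (cmod (?\<Delta> p))\<^sup>2 + (cmod (g p))\<^sup>2 / \<eta>)"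
  proof (rule integral_mono)
    show "- 2 * (?\<Delta> p \<bullet> g p) \<le> \<eta> * (cmod (?\<Delta> p))\<^sup>2 + (cmod (g p))\<^sup>2 / \<eta>" for p
      using \<eta> by (rule inner_ge_weighted_squares)
  qed (use \<Delta> in \<open>auto simp: inner_add_left intro!: int1 int2 g f''\<close>)
  also have "\<dots> = \<eta> * (LINT p|lborel. (cmod (?\<Delta> p))\<^sup>2) + L2_norm_sq (strip_lebesgue a) g / \<eta>"
    using \<Delta> by (simp add: test_functions_L2(2)[OF weight_one g] int1 g)
  finally show ?thesis
    by (simp add: test_functions_energy[OF weight_one f] int1 f')
qed

text \<open>
  The limit over \<open>m\<close> in the preceding estimate, with
  \<open>f = \<xi> n\<close> and \<open>g = \<xi> m\<close>, removes the last term, and \<open>\<eta> \<rightarrow> 0\<close> the Laplacian term.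
\<close>

lemma flat_form_closable:
  assumes a: "a > 0" and \<xi>: "\<And>n::nat. \<xi> n \<in> test_functions a"
    and lim: "(\<lambda>n. L2_norm_sq (strip_lebesgue a) (\<xi> n)) \<longlonglongrightarrow> 0"
    and cauchy: "\<And>e. e > 0 \<Longrightarrow> \<exists>N. \<forall>m\<ge>N. \<forall>n\<ge>N. energy a (\<lambda>_. 1)
      (\<lambda>p. partial1 (\<xi> m) p - partial1 (\<xi> n) p) (\<lambda>p. partial2 (\<xi> m) p - partial2 (\<xi> n) p) < e"
  shows "(\<lambda>n. energy a (\<lambda>_. 1) (partial1 (\<xi> n)) (partial2 (\<xi> n))) \<longlonglongrightarrow> 0"
proof (rule LIMSEQ_I)
  fix r :: real assume "r > 0"
  then obtain N where N: "\<And>m n. m \<ge> N \<Longrightarrow> n \<ge> N \<Longrightarrow> energy a (\<lambda>_. 1)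
      (\<lambda>p. partial1 (\<xi> m) p - partial1 (\<xi> n) p) (\<lambda>p. partial2 (\<xi> m) p - partial2 (\<xi> n) p) < r / 2"
    using cauchy[of "r / 2"] by (auto simp del: half_gt_zero_iff)
  have "energy a (\<lambda>_. 1) (partial1 (\<xi> n)) (partial2 (\<xi> n)) \<le> r / 2" if n: "n \<ge> N" for n
  proof -
    let ?A = "energy a (\<lambda>_. 1) (partial1 (\<xi> n)) (partial2 (\<xi> n))"
    define L where "L = (LINT p|lborel. (cmod (partial1 (partial1 (\<xi> n)) p + partial2 (partial2 (\<xi> n)) p))\<^sup>2)"
    have *: "?A \<le> r / 2 + \<eta> * L" if "\<eta> > 0" for \<eta>
    proof (rule LIMSEQ_le_const)
      show "(\<lambda>m. r / 2 + \<eta> * L + L2_norm_sq (strip_lebesgue a) (\<xi> m) / \<eta>) \<longlonglongrightarrow> r / 2 + \<eta> * L"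
        using tendsto_add[OF tendsto_const[of "r / 2 + \<eta> * L"] tendsto_divide[OF lim tendsto_const[of \<eta>]]] that
        by simp
      show "\<exists>N'. \<forall>m\<ge>N'. ?A \<le> r / 2 + \<eta> * L + L2_norm_sq (strip_lebesgue a) (\<xi> m) / \<eta>"
      proof (intro exI[of _ N] allI impI)
        fix m assume "m \<ge> N"
        then show "?A \<le> r / 2 + \<eta> * L + L2_norm_sq (strip_lebesgue a) (\<xi> m) / \<eta>"
          using test_functions_flat_energy_le[OF a \<xi>[of n] \<xi>[of m] that] N[OF n, of m]
          unfolding L_def by linarith
      qed
    qed
    have "((\<lambda>\<eta>. r / 2 + \<eta> * L) \<longlongrightarrow> r / 2 + 0 * L) (at_right 0)"
      by (intro tendsto_intros)
    moreover have "\<forall>\<^sub>F \<eta> in at_right 0. ?A \<le> r / 2 + \<eta> * L"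
      using eventually_at_right_less[of "0 :: real"] by (rule eventually_mono) (rule *)
    ultimately show ?thesis
      using tendsto_lowerbound trivial_limit_at_right_real by fastforce
  qed
  then show "\<exists>N. \<forall>n\<ge>N. norm (energy a (\<lambda>_. 1) (partial1 (\<xi> n)) (partial2 (\<xi> n)) - 0) < r"
    using \<open>r > 0\<close> energy_nonneg by (intro exI[of _ N]) fastforce
qed

section \<open>Closure of the weighted form and lower bounds on it\<close>

lemma origin_in_strip: "a > 0 \<Longrightarrow> (0, 0) \<in> strip a"
  by (simp add: strip_def)

text \<open>A sequence approximating \<psi> in the flat Sobolev norm also works for the weighted
  form, because \<open>h\<close> and \<open>1 / h\<close> are at most \<open>L\<close>. Its form
  values tend to the energy of the weak gradient.\<close>

lemma form_closure_rel_exists: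
  assumes a: "a > 0" and h: "weight a h" and L: "\<And>p. p \<in> strip a \<Longrightarrow> h p \<le> L" "\<And>p. p \<in> strip a \<Longrightarrow> 1 / h p \<le> L"
    and \<psi>: "\<psi> \<in> W12_0 a"
  shows "\<exists>v. form_closure_rel (strip_measure a h) (test_functions a)
    (\<lambda>\<phi>. energy a h (partial1 \<phi>) (partial2 \<phi>)) \<psi> v"
proof -
  obtain g1 g2 \<phi> where wg: "has_weak_gradient a \<psi> g1 g2" and \<phi>: "\<And>n::nat. \<phi> n \<in> test_functions a"
    and lim: "(\<lambda>n. L2_norm_sq (strip_lebesgue a) (\<lambda>p. \<phi> n p - \<psi> p)
              + L2_norm_sq (strip_lebesgue a) (\<lambda>p. partial1 (\<phi> n) p - g1 p)
              + L2_norm_sq (strip_lebesgue a) (\<lambda>p. partial2 (\<phi> n) p - g2 p)) \<longlonglongrightarrow> 0"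
    using \<psi> unfolding W12_0_def by blast
  let ?S = "\<lambda>n. L2_norm_sq (strip_lebesgue a) (\<lambda>p. \<phi> n p - \<psi> p)
              + L2_norm_sq (strip_lebesgue a) (\<lambda>p. partial1 (\<phi> n) p - g1 p)
              + L2_norm_sq (strip_lebesgue a) (\<lambda>p. partial2 (\<phi> n) p - g2 p)"
  let ?D = "\<lambda>n. energy a h (\<lambda>p. partial1 (\<phi> n) p - g1 p) (\<lambda>p. partial2 (\<phi> n) p - g2 p)"
  have flat: "\<psi> \<in> L2_functions (strip_lebesgue a)" "finite_energy a (\<lambda>_. 1) g1 g2"
    using wg by (auto simp: has_weak_gradient_def finite_energy_def)
  have L1: "h p \<le> L * 1" "1 / h p \<le> L * (1 / 1)" if "p \<in> strip a" for p
    using L[OF that] by auto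
  have cmp: "finite_energy a h u v" "energy a h u v \<le> L * energy a (\<lambda>_. 1) u v"
    if "finite_energy a (\<lambda>_. 1) u v" for u v
    by (rule energy_comparison[OF h weight_one _ _ that]; erule L1)+
  have mono: "u \<in> L2_functions (strip_measure a h)"
      "L2_norm_sq (strip_measure a h) u \<le> L * L2_norm_sq (strip_lebesgue a) u"
    if "u \<in> L2_functions (strip_lebesgue a)" for u
    by (rule L2_strip_measure_mono[OF h weight_one _ that]; erule L1)+
  note g = cmp(1)[OF flat(2)]
  note \<phi>E = test_functions_finite_energy[OF h \<phi>]
  \<comment> \<open>The sign of \<open>L\<close> follows from a single point of the strip, where
    \<open>h\<close> is positive and at most \<open>L\<close>.\<close>
  have L0: "0 \<le> L"
    using L(1)[OF origin_in_strip[OF a]] h origin_in_strip[OF a] by (force simp: weight_def)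
  have LS: "(\<lambda>n. L * ?S n) \<longlonglongrightarrow> 0"
    using tendsto_mult_left[OF lim, of L] by simp
  have "L2_norm_sq (strip_measure a h) (\<lambda>p. \<phi> n p - \<psi> p) \<le> L * ?S n" for n
  proof -
    have "L2_norm_sq (strip_measure a h) (\<lambda>p. \<phi> n p - \<psi> p) \<le> L * L2_norm_sq (strip_lebesgue a) (\<lambda>p. \<phi> n p - \<psi> p)"
      by (intro mono(2) L2_functions_diff flat(1) test_functions_L2(1) weight_one \<phi>)
    also have "\<dots> \<le> L * ?S n"
      using L0 by (intro mult_left_mono) (auto simp: L2_norm_sq_nonneg)
    finally show ?thesis .
  qed
  then have lim\<psi>: "(\<lambda>n. L2_norm_sq (strip_measure a h) (\<lambda>p. \<phi> n p - \<psi> p)) \<longlonglongrightarrow> 0"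
    by (intro tendsto_sandwich[OF _ _ tendsto_const LS]) (auto simp: L2_norm_sq_nonneg)
  have "?D n \<le> L * ?S n" for n
  proof -
    have "?D n \<le> L * energy a (\<lambda>_. 1) (\<lambda>p. partial1 (\<phi> n) p - g1 p) (\<lambda>p. partial2 (\<phi> n) p - g2 p)"
      by (intro cmp(2) finite_energy_diff flat(2) test_functions_finite_energy weight_one \<phi>)
    also have "\<dots> \<le> L * ?S n"
      using L0 by (intro mult_left_mono) (auto simp: energy_def L2_norm_sq_nonneg)
    finally show ?thesis .
  qed
  then have D: "?D \<longlonglongrightarrow> 0"
    by (intro tendsto_sandwich[OF _ _ tendsto_const LS]) (auto simp: energy_nonneg)
  have "form_closure_rel (strip_measure a h) (test_functions a)
    (\<lambda>\<phi>. energy a h (partial1 \<phi>) (partial2 \<phi>)) \<psi> (energy a h g1 g2)"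
    unfolding form_closure_rel_def
  proof (intro conjI exI[of _ \<phi>] allI impI)
    show "\<psi> \<in> L2_functions (strip_measure a h)"
      by (rule mono(1)[OF flat(1)])
    show "(\<lambda>n. energy a h (partial1 (\<phi> n)) (partial2 (\<phi> n))) \<longlonglongrightarrow> energy a h g1 g2"
      by (rule tendsto_of_sqrt_dist[OF energy_nonneg energy_nonneg D energy_sqrt_dist[OF h \<phi>E g]])
    \<comment> \<open>A quarter of \<open>e\<close> suffices for each distance to the limit
      gradient, since \<open>energy_diff_le\<close> doubles both of them.\<close>
    fix e :: real assume "e > 0"
    then have "\<forall>\<^sub>F n in sequentially. ?D n < e / 4"
      by (intro order_tendstoD(2)[OF D]) simp
    then obtain N where N: "\<And>n. n \<ge> N \<Longrightarrow> ?D n < e / 4"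
      by (auto simp: eventually_sequentially)
    have "energy a h (partial1 (\<lambda>x. \<phi> m x - \<phi> n x)) (partial2 (\<lambda>x. \<phi> m x - \<phi> n x)) < e"
      if "m \<ge> N" "n \<ge> N" for m n
      using energy_diff_le[OF h finite_energy_diff[OF \<phi>E g] finite_energy_diff[OF \<phi>E g], of m n]
        N[OF that(1)] N[OF that(2)]
      by (simp add: partial_diff[OF \<phi> \<phi>])
    then show "\<exists>N. \<forall>m\<ge>N. \<forall>n\<ge>N.
        energy a h (partial1 (\<lambda>x. \<phi> m x - \<phi> n x)) (partial2 (\<lambda>x. \<phi> m x - \<phi> n x)) < e"
      by blast
  qed (use \<phi> lim\<psi> in auto)
  then show ?thesis
    by blast
qed

text \<open>The difference of two approximating sequences tends to 0 in norm and is Cauchy for the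
  form. Both properties carry over to the flat form, whose closability makes the flat energies
  vanish in the limit; the weighted energies follow.\<close>

lemma form_closure_rel_unique:
  assumes a: "a > 0" and h: "weight a h"
    and L: "\<And>p. p \<in> strip a \<Longrightarrow> h p \<le> L" "\<And>p. p \<in> strip a \<Longrightarrow> 1 / h p \<le> L"
    and v: "form_closure_rel (strip_measure a h) (test_functions a)
      (\<lambda>\<phi>. energy a h (partial1 \<phi>) (partial2 \<phi>)) \<psi> v"
    and w: "form_closure_rel (strip_measure a h) (test_functions a)
      (\<lambda>\<phi>. energy a h (partial1 \<phi>) (partial2 \<phi>)) \<psi> w"
  shows "v = w"
proof -
  let ?q = "\<lambda>\<phi>. energy a h (partial1 \<phi>) (partial2 \<phi>)"
  let ?q1 = "\<lambda>\<phi>. energy a (\<lambda>_. 1) (partial1 \<phi>) (partial2 \<phi>)"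
  let ?M = "strip_measure a h"
  obtain f where f: "\<And>n::nat. f n \<in> test_functions a"
    and f\<psi>: "(\<lambda>n. L2_norm_sq ?M (\<lambda>x. f n x - \<psi> x)) \<longlonglongrightarrow> 0"
    and fc: "\<And>e. e > 0 \<Longrightarrow> \<exists>N. \<forall>m\<ge>N. \<forall>n\<ge>N. ?q (\<lambda>x. f m x - f n x) < e"
    and fv: "(\<lambda>n. ?q (f n)) \<longlonglongrightarrow> v"
    using v unfolding form_closure_rel_def by blast
  obtain g where g: "\<And>n::nat. g n \<in> test_functions a"
    and g\<psi>: "(\<lambda>n. L2_norm_sq ?M (\<lambda>x. g n x - \<psi> x)) \<longlonglongrightarrow> 0"
    and gc: "\<And>e. e > 0 \<Longrightarrow> \<exists>N. \<forall>m\<ge>N. \<forall>n\<ge>N. ?q (\<lambda>x. g m x - g n x) < e"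
    and gw: "(\<lambda>n. ?q (g n)) \<longlonglongrightarrow> w"
    using w unfolding form_closure_rel_def by blast
  have \<psi>: "\<psi> \<in> L2_functions ?M"
    using v by (simp add: form_closure_rel_def)
  have L0: "0 < L"
    using L(1)[OF origin_in_strip[OF a]] h origin_in_strip[OF a] by (force simp: weight_def)
  have L': "1 \<le> L * h p" "1 / 1 \<le> L * (1 / h p)" if "p \<in> strip a" for p
    using L[OF that] h that by (auto simp: weight_def field_simps)
  define \<xi> where "\<xi> n = (\<lambda>p. f n p - g n p)" for n
  have \<xi>: "\<xi> n \<in> test_functions a" for n
    unfolding \<xi>_def by (intro test_functions_diff f g)
  have L1: "h p \<le> L * 1" "1 / h p \<le> L * (1 / 1)" if "p \<in> strip a" for p
    using L[OF that] by auto
  have le_flat: "?q \<phi> \<le> L * ?q1 \<phi>" and flat_le: "?q1 \<phi> \<le> L * ?q \<phi>"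
    if "\<phi> \<in> test_functions a" for \<phi>
    by (rule energy_comparison(2)[OF h weight_one _ _ test_functions_finite_energy[OF weight_one that]]; erule L1)
      (rule energy_comparison(2)[OF weight_one h _ _ test_functions_finite_energy[OF h that]]; erule L')
  have "(\<lambda>n. L * (2 * L2_norm_sq ?M (\<lambda>x. f n x - \<psi> x) + 2 * L2_norm_sq ?M (\<lambda>x. g n x - \<psi> x)))
      \<longlonglongrightarrow> L * (2 * 0 + 2 * 0)"
    by (intro tendsto_intros f\<psi> g\<psi>)
  moreover have "L2_norm_sq (strip_lebesgue a) (\<xi> n)
      \<le> L * (2 * L2_norm_sq ?M (\<lambda>x. f n x - \<psi> x) + 2 * L2_norm_sq ?M (\<lambda>x. g n x - \<psi> x))" for n
  proof -
    have "L2_norm_sq (strip_lebesgue a) (\<xi> n) \<le> L * L2_norm_sq ?M (\<xi> n)"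
      by (rule L2_strip_measure_mono(2)[OF weight_one h _ test_functions_L2(1)[OF h \<xi>]]) (erule L'(1))
    also have "L2_norm_sq ?M (\<xi> n)
        \<le> 2 * L2_norm_sq ?M (\<lambda>x. f n x - \<psi> x) + 2 * L2_norm_sq ?M (\<lambda>x. g n x - \<psi> x)"
      using L2_norm_sq_diff_le[OF L2_functions_diff[OF test_functions_L2(1)[OF h f[of n]] \<psi>]
          L2_functions_diff[OF test_functions_L2(1)[OF h g[of n]] \<psi>]]
      by (simp add: \<xi>_def)
    finally show ?thesis
      using L0 by simp
  qed
  ultimately have lim\<xi>: "(\<lambda>n. L2_norm_sq (strip_lebesgue a) (\<xi> n)) \<longlonglongrightarrow> 0"
    by (intro Lim_null_comparison[of "\<lambda>n. L2_norm_sq (strip_lebesgue a) (\<xi> n)"])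
      (simp_all add: L2_norm_sq_nonneg)
  have cauchy: "\<exists>N. \<forall>m\<ge>N. \<forall>n\<ge>N. energy a (\<lambda>_. 1)
      (\<lambda>p. partial1 (\<xi> m) p - partial1 (\<xi> n) p) (\<lambda>p. partial2 (\<xi> m) p - partial2 (\<xi> n) p) < e"
    if "e > 0" for e
  proof -
    \<comment> \<open>The 4 compensates the two doublings in \<open>energy_diff_le\<close>, and
      \<open>L\<close> the passage from the weighted to the flat energy.\<close>
    from that L0 have e: "e / (4 * L) > 0"
      by simp
    obtain N1 where N1: "\<And>m n. m \<ge> N1 \<Longrightarrow> n \<ge> N1 \<Longrightarrow> ?q (\<lambda>x. f m x - f n x) < e / (4 * L)"
      using fc[OF e] by blast
    obtain N2 where N2: "\<And>m n. m \<ge> N2 \<Longrightarrow> n \<ge> N2 \<Longrightarrow> ?q (\<lambda>x. g m x - g n x) < e / (4 * L)"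
      using gc[OF e] by blast
    have "energy a (\<lambda>_. 1)
      (\<lambda>p. partial1 (\<xi> m) p - partial1 (\<xi> n) p) (\<lambda>p. partial2 (\<xi> m) p - partial2 (\<xi> n) p) < e"
      if "m \<ge> max N1 N2" "n \<ge> max N1 N2" for m n
    proof -
      let ?u = "\<lambda>x. f m x - f n x" and ?v = "\<lambda>x. g m x - g n x"
      have u: "?u \<in> test_functions a" and v: "?v \<in> test_functions a"
        by (intro test_functions_diff f g)+
      have eq: "(\<lambda>p. \<xi> m p - \<xi> n p) = (\<lambda>p. ?u p - ?v p)"
        by (auto simp: \<xi>_def)
      have "?q1 (\<lambda>p. \<xi> m p - \<xi> n p) \<le> L * ?q (\<lambda>p. ?u p - ?v p)"
        using flat_le[OF test_functions_diff[OF u v]] by (simp only: eq)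
      also have "?q (\<lambda>p. ?u p - ?v p) \<le> 2 * ?q ?u + 2 * ?q ?v"
        using energy_diff_le[OF h test_functions_finite_energy[OF h u] test_functions_finite_energy[OF h v]]
        by (simp only: partial_diff[OF u v])
      also have "\<dots> < e / L"
        using N1[of m n] N2[of m n] that by simp
      finally show ?thesis
        using L0 by (simp add: partial_diff[OF \<xi> \<xi>])
    qed
    then show ?thesis
      by blast
  qed
  have flat0: "(\<lambda>n. ?q1 (\<xi> n)) \<longlonglongrightarrow> 0"
    by (rule flat_form_closable[OF a \<xi> lim\<xi> cauchy])
  have "(\<lambda>n. L * ?q1 (\<xi> n)) \<longlonglongrightarrow> 0"
    using tendsto_mult_left[OF flat0, of L] by simp
  then have q0: "(\<lambda>n. ?q (\<xi> n)) \<longlonglongrightarrow> 0"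
    by (rule Lim_null_comparison[rotated]) (simp add: energy_nonneg le_flat[OF \<xi>])
  have dist: "\<bar>sqrt (?q (f n)) - sqrt (?q (g n))\<bar> \<le> sqrt (?q (\<xi> n))" for n
    using energy_sqrt_dist[OF h test_functions_finite_energy[OF h f] test_functions_finite_energy[OF h g], of n n]
    by (simp add: \<xi>_def partial_diff[OF f g])
  have sq0: "(\<lambda>n. sqrt (?q (\<xi> n))) \<longlonglongrightarrow> 0"
    using tendsto_real_sqrt[OF q0] by simp
  have "(\<lambda>n. sqrt (?q (f n)) - sqrt (?q (g n))) \<longlonglongrightarrow> 0"
    by (rule Lim_null_comparison[OF _ sq0]) (simp add: dist)
  moreover have "(\<lambda>n. sqrt (?q (f n)) - sqrt (?q (g n))) \<longlonglongrightarrow> sqrt v - sqrt w"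
    using tendsto_diff[OF tendsto_real_sqrt[OF fv] tendsto_real_sqrt[OF gw]] .
  ultimately have "sqrt v - sqrt w = 0"
    by (intro LIMSEQ_unique)
  \<comment> \<open>\<open>sqrt\<close> is extended to negative numbers as an odd function, hence
    injective on all reals; no sign of \<open>v\<close> or \<open>w\<close> is involved.\<close>
  then show "v = w"
    by simp
qed

text \<open>Along one sequence that realises the value of the closure, the norms converge together
  with the form values, so an inequality valid on test functions is inherited by every \<psi> of the
  form domain.\<close>

lemma Dirichlet_form_ge:
  assumes a: "a > 0" and h: "weight a h"
    and L: "\<And>p. p \<in> strip a \<Longrightarrow> h p \<le> L" "\<And>p. p \<in> strip a \<Longrightarrow> 1 / h p \<le> L"
    and ge: "\<And>\<phi>. \<phi> \<in> test_functions a \<Longrightarrow>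
      E * L2_norm_sq (strip_measure a h) \<phi> \<le> energy a h (partial1 \<phi>) (partial2 \<phi>)"
    and \<psi>: "\<psi> \<in> W12_0 a"
  shows "E * L2_norm_sq (strip_measure a h) \<psi> \<le> Dirichlet_form a h \<psi>"
proof -
  let ?M = "strip_measure a h"
  let ?R = "form_closure_rel ?M (test_functions a) (\<lambda>\<phi>. energy a h (partial1 \<phi>) (partial2 \<phi>)) \<psi>"
  obtain v where v: "?R v"
    using form_closure_rel_exists[OF a h L \<psi>] by blast
  have "Dirichlet_form a h \<psi> = v"
    unfolding Dirichlet_form_def form_closure_def
    by (rule the_equality[of ?R, OF v form_closure_rel_unique[OF a h L _ v]])
  moreover obtain f where f: "\<And>n::nat. f n \<in> test_functions a"
    and f\<psi>: "(\<lambda>n. L2_norm_sq ?M (\<lambda>x. f n x - \<psi> x)) \<longlonglongrightarrow> 0"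
    and fv: "(\<lambda>n. energy a h (partial1 (f n)) (partial2 (f n))) \<longlonglongrightarrow> v" and "\<psi> \<in> L2_functions ?M"
    using v unfolding form_closure_rel_def by blast
  have "(\<lambda>n. L2_norm_sq ?M (f n)) \<longlonglongrightarrow> L2_norm_sq ?M \<psi>"
    by (rule tendsto_of_sqrt_dist[OF L2_norm_sq_nonneg L2_norm_sq_nonneg f\<psi>
          L2_norm_sq_sqrt_dist[OF test_functions_L2(1)[OF h f] \<open>\<psi> \<in> L2_functions ?M\<close>]])
  then have "E * L2_norm_sq ?M \<psi> \<le> v"
    using ge[OF f] by (intro LIMSEQ_le[OF tendsto_mult_left fv]) auto
  ultimately show ?thesis
    by simp
qed

section \<open>The transverse inequality\<close>

text \<open>The weight \<open>h_twist\<close> on a single transverse segment, with the twist frozen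
  to a number.\<close>

definition twist_factor :: "real \<Rightarrow> real \<Rightarrow> real" where
  "twist_factor \<sigma> t = sqrt (1 + t\<^sup>2 * \<sigma>\<^sup>2)"

lemma twist_factor_pos: "0 < twist_factor \<sigma> t"
  by (simp add: twist_factor_def add_pos_nonneg)

lemma twist_factor_sq: "(twist_factor \<sigma> t)\<^sup>2 = 1 + t\<^sup>2 * \<sigma>\<^sup>2"
  by (simp add: twist_factor_def)

lemma twist_factor_derivative:
  "(twist_factor \<sigma> has_real_derivative \<sigma>\<^sup>2 * t / twist_factor \<sigma> t) (at t)"
proof -
  have "0 < 1 + t\<^sup>2 * \<sigma>\<^sup>2"
    by (simp add: add_pos_nonneg)
  moreover have "((\<lambda>t. 1 + t\<^sup>2 * \<sigma>\<^sup>2) has_real_derivative 2 * t * \<sigma>\<^sup>2) (at t)"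
    by (auto intro!: derivative_eq_intros)
  ultimately have "((\<lambda>t. sqrt (1 + t\<^sup>2 * \<sigma>\<^sup>2)) has_real_derivative
      inverse (sqrt (1 + t\<^sup>2 * \<sigma>\<^sup>2)) / 2 * (2 * t * \<sigma>\<^sup>2)) (at t)"
    by (intro DERIV_chain2[OF DERIV_real_sqrt])
  then show ?thesis
    unfolding twist_factor_def by (simp add: field_simps)
qed

text \<open>
  This is $w u'/u$ for $w = $ \<open>twist_factor \<sigma>\<close> and the positive function
  $u(t) = w(t)^{-1/2} \cos(\beta t)$.
\<close>

definition transverse_drift :: "real \<Rightarrow> real \<Rightarrow> real \<Rightarrow> real" where
  "transverse_drift \<beta> \<sigma> t =
     - \<beta> * twist_factor \<sigma> t * tan (\<beta> * t) - \<sigma>\<^sup>2 * t / (2 * twist_factor \<sigma> t)"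

text \<open>The derivative of \<open>transverse_drift\<close>, with the squared secant written as 1
  + tan^2 so that the tangents cancel in the Riccati inequality.\<close>

definition transverse_drift' :: "real \<Rightarrow> real \<Rightarrow> real \<Rightarrow> real" where
  "transverse_drift' \<beta> \<sigma> t =
     - \<beta> * (\<sigma>\<^sup>2 * t / twist_factor \<sigma> t) * tan (\<beta> * t)
     - \<beta>\<^sup>2 * twist_factor \<sigma> t * (1 + (tan (\<beta> * t))\<^sup>2)
     - \<sigma>\<^sup>2 / (2 * twist_factor \<sigma> t ^ 3)"

lemma transverse_drift_derivative:
  assumes "cos (\<beta> * t) \<noteq> 0"
  shows "(transverse_drift \<beta> \<sigma> has_real_derivative transverse_drift' \<beta> \<sigma> t) (at t)"
proof -
  let ?w = "twist_factor \<sigma> t"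
  note pos = twist_factor_pos[of \<sigma> t]
  have tan: "((\<lambda>t. tan (\<beta> * t)) has_real_derivative \<beta> * (1 + (tan (\<beta> * t))\<^sup>2)) (at t)"
  proof -
    have "((\<lambda>t. tan (\<beta> * t)) has_real_derivative inverse ((cos (\<beta> * t))\<^sup>2) * \<beta>) (at t)"
      by (rule DERIV_chain2[of tan _ "\<lambda>t. \<beta> * t", OF DERIV_tan[OF assms]])
        (auto intro!: derivative_eq_intros)
    then show ?thesis
      by (simp add: tan_sec[OF assms] power_inverse mult.commute)
  qed
  have "((\<lambda>t. \<sigma>\<^sup>2 * t / (2 * twist_factor \<sigma> t)) has_real_derivative
      (\<sigma>\<^sup>2 * (2 * ?w) - \<sigma>\<^sup>2 * t * (2 * (\<sigma>\<^sup>2 * t / ?w))) / (2 * ?w * (2 * ?w))) (at t)"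
    using pos by (auto intro!: derivative_eq_intros twist_factor_derivative)
  also have "(\<sigma>\<^sup>2 * (2 * ?w) - \<sigma>\<^sup>2 * t * (2 * (\<sigma>\<^sup>2 * t / ?w))) / (2 * ?w * (2 * ?w))
      = \<sigma>\<^sup>2 * (?w\<^sup>2 - t\<^sup>2 * \<sigma>\<^sup>2) / (2 * ?w ^ 3)"
    using pos by (simp add: field_simps power2_eq_square power3_eq_cube)
  also have "\<dots> = \<sigma>\<^sup>2 / (2 * ?w ^ 3)"
    by (simp add: twist_factor_sq)
  finally have q: "((\<lambda>t. \<sigma>\<^sup>2 * t / (2 * twist_factor \<sigma> t)) has_real_derivative \<sigma>\<^sup>2 / (2 * ?w ^ 3)) (at t)" .
  have "((\<lambda>t. - \<beta> * twist_factor \<sigma> t * tan (\<beta> * t) - \<sigma>\<^sup>2 * t / (2 * twist_factor \<sigma> t)) has_real_derivative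
      - \<beta> * (\<sigma>\<^sup>2 * t / ?w) * tan (\<beta> * t) + \<beta> * (1 + (tan (\<beta> * t))\<^sup>2) * (- \<beta> * ?w) - \<sigma>\<^sup>2 / (2 * ?w ^ 3)) (at t)"
    by (intro DERIV_diff DERIV_mult tan q DERIV_cmult twist_factor_derivative)
  also have "- \<beta> * (\<sigma>\<^sup>2 * t / ?w) * tan (\<beta> * t) + \<beta> * (1 + (tan (\<beta> * t))\<^sup>2) * (- \<beta> * ?w) - \<sigma>\<^sup>2 / (2 * ?w ^ 3)
      = transverse_drift' \<beta> \<sigma> t"
    by (simp add: transverse_drift'_def power2_eq_square algebra_simps)
  finally show ?thesis
    unfolding transverse_drift_def .
qed

text \<open>The condition \<open>t\<^sup>2 * \<sigma>\<^sup>2 \<le> 2\<close> makes \<open>u\<close> a supersolution: $(w u')' + \beta^2 w u \le 0$.\<close>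

lemma transverse_drift_riccati:
  assumes "t\<^sup>2 * \<sigma>\<^sup>2 \<le> 2"
  shows "transverse_drift' \<beta> \<sigma> t + (transverse_drift \<beta> \<sigma> t)\<^sup>2 / twist_factor \<sigma> t
    \<le> - \<beta>\<^sup>2 * twist_factor \<sigma> t"
proof -
  define w where "w = twist_factor \<sigma> t"
  define T where "T = tan (\<beta> * t)"
  have w: "w > 0" "w\<^sup>2 = 1 + t\<^sup>2 * \<sigma>\<^sup>2"
    by (simp_all add: w_def twist_factor_pos twist_factor_sq)
  have "(- \<beta> * w * T - \<sigma>\<^sup>2 * t / (2 * w))\<^sup>2 / w
      = \<beta>\<^sup>2 * w * T\<^sup>2 + \<beta> * \<sigma>\<^sup>2 * t * T / w + \<sigma>\<^sup>2 * (t\<^sup>2 * \<sigma>\<^sup>2) / (4 * w ^ 3)"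
    using w(1) by (simp add: field_simps power2_eq_square power3_eq_cube)
  then have "transverse_drift' \<beta> \<sigma> t + (transverse_drift \<beta> \<sigma> t)\<^sup>2 / w
      = - \<beta>\<^sup>2 * w + (\<sigma>\<^sup>2 * (t\<^sup>2 * \<sigma>\<^sup>2) / (4 * w ^ 3) - \<sigma>\<^sup>2 / (2 * w ^ 3))"
    by (simp add: transverse_drift_def transverse_drift'_def w_def T_def algebra_simps)
  also have "\<sigma>\<^sup>2 * (t\<^sup>2 * \<sigma>\<^sup>2) / (4 * w ^ 3) - \<sigma>\<^sup>2 / (2 * w ^ 3) = \<sigma>\<^sup>2 * (t\<^sup>2 * \<sigma>\<^sup>2 - 2) / (4 * w ^ 3)"
    using w(1) by (simp add: field_simps)
  \<comment> \<open>All terms with the tangent have cancelled. The sign of this remainder is that of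
    t^2 \<sigma>^2 - 2 when \<sigma> is nonzero, the source of the bound by
    \<open>sqrt 2\<close>.\<close>
  also have "\<dots> \<le> 0"
    using assms w(1) by (intro divide_nonpos_pos mult_nonneg_nonpos) auto
  finally show ?thesis
    by (simp add: w_def)
qed

text \<open>Ground state substitution, with w, F, F' for the twist factor, the drift and its
  derivative: w |f'|^2 - \<beta>^2 w |f|^2 exceeds the derivative of F |f|^2 by |w f' - F f|^2 / w -
  (F' + F^2 / w + \<beta>^2 w) |f|^2. The square is nonnegative, the bracket is nonpositive by the
  Riccati inequality, and the derivative integrates to 0.\<close>

lemma transverse_inequality:
  fixes f f' :: "real \<Rightarrow> complex"
  assumes a: "a > 0" and \<sigma>: "a * \<bar>\<sigma>\<bar> \<le> sqrt 2"
    and d: "\<And>t. (f has_vector_derivative f' t) (at t)" and c: "continuous_on UNIV f'"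
    and b: "0 < b" "b < a" "\<And>t. \<bar>t\<bar> > b \<Longrightarrow> f t = 0"
  shows "0 \<le> (LINT t|lborel. twist_factor \<sigma> t * (cmod (f' t))\<^sup>2 - E1 a * (twist_factor \<sigma> t * (cmod (f t))\<^sup>2))"
proof -
  define \<beta> where "\<beta> = pi / (2 * a)"
  have \<beta>: "E1 a = \<beta>\<^sup>2" "\<beta> > 0"
    using a by (auto simp: E1_def \<beta>_def power_divide)
  let ?w = "twist_factor \<sigma>" and ?F = "transverse_drift \<beta> \<sigma>" and ?F' = "transverse_drift' \<beta> \<sigma>"
  define G where "G t = ?w t * (cmod (f' t))\<^sup>2 - E1 a * (?w t * (cmod (f t))\<^sup>2)" for t
  \<comment> \<open>The drift is singular at \<open>a\<close> and \<open>-a\<close>, where the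
    cosine vanishes. The radius \<open>r\<close> lies strictly between the support of
    \<open>f\<close> and these points, so the fundamental theorem applies and both boundary terms
    are 0.\<close>
  define r where "r = (b + a) / 2"
  have r: "0 < r" "b < r" "r < a"
    using b by (auto simp: r_def)
  have cf: "continuous_on UNIV f"
    using d by (intro continuous_at_imp_continuous_on) (blast intro: has_vector_derivative_continuous)
  have f0: "f t = 0" "f' t = 0" if "\<bar>t\<bar> > b" for t
  proof -
    have "(f has_vector_derivative 0) (at t)"
      by (rule has_vector_derivative_0_of_open[of "{x. \<bar>x\<bar> > b}"])
        (use that b(3) in \<open>auto intro!: open_Collect_less continuous_intros\<close>)
    then show "f' t = 0"
      using assms(3) vector_derivative_at by metis
  qed (use b(3) that in auto)
  have "compactly_supported_in UNIV G"
    unfolding compactly_supported_in_def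
  proof (intro conjI exI[of _ "{-b..b}"])
    show "continuous_on UNIV G"
      unfolding G_def twist_factor_def by (intro continuous_intros cf c)
    show "\<forall>p. p \<notin> {-b..b} \<longrightarrow> G p = 0"
      by (auto simp: G_def f0)
  qed auto
  then have int: "integrable lborel G"
    by (rule compactly_supported_in_integrable)
  have GU: "(G has_integral (LINT t|lborel. G t)) UNIV"
    by (rule has_integral_integral_lborel[OF int])
  define H where "H t = ?F t * (2 * (f t \<bullet> f' t)) + ?F' t * (cmod (f t))\<^sup>2" for t
  have H: "((\<lambda>t. ?F t * (cmod (f t))\<^sup>2) has_vector_derivative H t) (at t)" if "\<bar>t\<bar> < a" for t
  proof -
    have "\<bar>\<beta> * t\<bar> < pi / 2"
      using that a \<beta>(2) by (simp add: \<beta>_def abs_mult field_simps)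
    then have "- (pi / 2) < \<beta> * t" "\<beta> * t < pi / 2"
      by linarith+
    then have "cos (\<beta> * t) \<noteq> 0"
      using cos_gt_zero_pi by force
    then have F: "(?F has_vector_derivative ?F' t) (at t)"
      by (intro transverse_drift_derivative[THEN has_real_derivative_iff_has_vector_derivative[THEN iffD1]])
    have "((\<lambda>t. f t \<bullet> f t) has_vector_derivative f t \<bullet> f' t + f' t \<bullet> f t) (at t)"
      by (rule bounded_bilinear.has_vector_derivative[OF bounded_bilinear_inner d d])
    from has_vector_derivative_mult[OF F this] show ?thesis
      by (simp add: H_def power2_norm_eq_inner inner_commute[of "f' t" "f t"])
  qed
  have "(H has_integral (?F r * (cmod (f r))\<^sup>2 - ?F (-r) * (cmod (f (-r)))\<^sup>2)) {-r..r}"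
    using H r by (intro fundamental_theorem_of_calculus[of "-r" r "\<lambda>t. ?F t * (cmod (f t))\<^sup>2" H])
      (auto intro: has_vector_derivative_at_within)
  then have "(H has_integral 0) {-r..r}"
    using r f0(1)[of r] f0(1)[of "-r"] by simp
  then have HU: "(H has_integral 0) UNIV"
    by (rule has_integral_on_superset) (use r in \<open>auto simp: H_def f0\<close>)
  have "H t \<le> G t" for t
  proof (cases "\<bar>t\<bar> > b")
    case True
    then show ?thesis
      by (simp add: H_def G_def f0)
  next
    case False
    have "(t * \<sigma>)\<^sup>2 \<le> (sqrt 2)\<^sup>2"
    proof (rule power2_le_iff_abs_le[THEN iffD2])
      have "\<bar>t * \<sigma>\<bar> \<le> a * \<bar>\<sigma>\<bar>"
        using False b by (simp add: abs_mult mult_right_mono)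
      then show "\<bar>t * \<sigma>\<bar> \<le> sqrt 2"
        using \<sigma> by simp
    qed simp
    then have "?F' t + (?F t)\<^sup>2 / ?w t \<le> - \<beta>\<^sup>2 * ?w t"
      by (intro transverse_drift_riccati) (simp add: power_mult_distrib)
    then have ric: "(?F' t + (?F t)\<^sup>2 / ?w t) * (cmod (f t))\<^sup>2 \<le> - \<beta>\<^sup>2 * ?w t * (cmod (f t))\<^sup>2"
      by (rule mult_right_mono) simp
    have "0 \<le> (cmod (?w t *\<^sub>R f' t - ?F t *\<^sub>R f t))\<^sup>2 / ?w t"
      using twist_factor_pos[of \<sigma> t] by simp
    also have "(cmod (?w t *\<^sub>R f' t - ?F t *\<^sub>R f t))\<^sup>2
        = ?w t * ?w t * (cmod (f' t))\<^sup>2 - 2 * ?w t * ?F t * (f t \<bullet> f' t) + ?F t * ?F t * (cmod (f t))\<^sup>2"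
      by (simp add: power2_norm_eq_inner inner_diff_left inner_diff_right inner_commute[of "f' t" "f t"] algebra_simps)
    also have "\<dots> / ?w t = ?w t * (cmod (f' t))\<^sup>2 - 2 * ?F t * (f t \<bullet> f' t) + (?F t)\<^sup>2 / ?w t * (cmod (f t))\<^sup>2"
      using twist_factor_pos[of \<sigma> t] by (simp add: add_divide_distrib diff_divide_distrib power2_eq_square)
    finally show ?thesis
      using ric by (simp add: H_def G_def \<beta>(1) algebra_simps)
  qed
  then have "0 \<le> (LINT t|lborel. G t)"
    by (intro has_integral_le[OF HU GU])
  then show ?thesis
    by (simp add: G_def)
qed

section \<open>From twisted to ruled strips\<close>

text \<open>Since (1 - x) (1 + x) \<le> 1, the upper factor 1 + x for \<open>h\<close> yields the
  lower factor 1 - x for \<open>1 / h\<close>. Both gradient components therefore lose the same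
  factor.\<close>

lemma reciprocal_ratio_bounds:
  fixes h h0 x :: real
  assumes "0 < h0" "0 \<le> x" "x < 1" "(1 - x) * h0 \<le> h" "h \<le> (1 + x) * h0"
  shows "0 < h" "(1 - x) * (1 / h0) \<le> 1 / h"
proof -
  have "0 < (1 - x) * h0"
    using assms by simp
  then show h: "0 < h"
    using assms(4) by linarith
  have "(1 - x) * h \<le> (1 - x) * ((1 + x) * h0)"
    using assms by (intro mult_left_mono) auto
  also have "\<dots> = h0 - x * x * h0"
    by (simp add: algebra_simps)
  also have "\<dots> \<le> h0"
    using assms by simp
  finally show "(1 - x) * (1 / h0) \<le> 1 / h"
    using h assms(1) by (simp add: field_simps)
qed

text \<open>The curvature enters only the first summand under the root. Scaling the twist summand as
  well, by (1 - x)^2 \<le> 1 or (1 + x)^2 \<ge> 1, goes in the right direction and lets the factor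
  leave the root.\<close>

lemma h_ruled_twist_bounds:
  fixes \<kappa> \<tau> \<theta> :: "real \<Rightarrow> real"
  assumes x: "\<bar>t * (\<kappa> s * cos (\<theta> s))\<bar> \<le> x" "x < 1"
  defines "h0 \<equiv> h_twist (\<lambda>s. \<tau> s - deriv \<theta> s) (s, t)"
  shows "(1 - x) * h0 \<le> h_ruled \<kappa> \<tau> \<theta> (s, t)" "h_ruled \<kappa> \<tau> \<theta> (s, t) \<le> (1 + x) * h0"
proof -
  let ?\<sigma> = "\<tau> s - deriv \<theta> s" and ?y = "t * \<kappa> s * cos (\<theta> s)"
  have y: "\<bar>?y\<bar> \<le> x"
    using x(1) by (simp add: mult.assoc)
  have x0: "0 \<le> x"
    using x by linarith
  have h0: "h0 = sqrt (1 + t\<^sup>2 * ?\<sigma>\<^sup>2)"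
    by (simp add: h0_def h_twist_def)
  have lo: "(1 - x)\<^sup>2 \<le> (1 - ?y)\<^sup>2" and up: "(1 - ?y)\<^sup>2 \<le> (1 + x)\<^sup>2"
    using y x x0 by (auto intro!: power_mono)
  have "(1 - x)\<^sup>2 \<le> 1" "1 \<le> (1 + x)\<^sup>2"
    using x(2) x0 by (auto simp: power_le_one one_le_power)
  then have lo': "(1 - x)\<^sup>2 * (t\<^sup>2 * ?\<sigma>\<^sup>2) \<le> t\<^sup>2 * ?\<sigma>\<^sup>2" and up': "t\<^sup>2 * ?\<sigma>\<^sup>2 \<le> (1 + x)\<^sup>2 * (t\<^sup>2 * ?\<sigma>\<^sup>2)"
    using mult_right_mono[of "(1 - x)\<^sup>2" 1 "t\<^sup>2 * ?\<sigma>\<^sup>2"] mult_right_mono[of 1 "(1 + x)\<^sup>2" "t\<^sup>2 * ?\<sigma>\<^sup>2"]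
    by auto
  have "(1 - x) * h0 = sqrt ((1 - x)\<^sup>2 * (1 + t\<^sup>2 * ?\<sigma>\<^sup>2))"
    using x(2) by (simp add: h0 real_sqrt_mult)
  also have "\<dots> \<le> h_ruled \<kappa> \<tau> \<theta> (s, t)"
    unfolding h_ruled_def using lo lo' by (simp add: distrib_left)
  finally show "(1 - x) * h0 \<le> h_ruled \<kappa> \<tau> \<theta> (s, t)" .
  have "h_ruled \<kappa> \<tau> \<theta> (s, t) \<le> sqrt ((1 + x)\<^sup>2 * (1 + t\<^sup>2 * ?\<sigma>\<^sup>2))"
    unfolding h_ruled_def using up up' by (simp add: distrib_left)
  also have "\<dots> = (1 + x) * h0"
    using x0 by (simp add: h0 real_sqrt_mult)
  finally show "h_ruled \<kappa> \<tau> \<theta> (s, t) \<le> (1 + x) * h0" .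
qed

section \<open>Regularity and positivity of the two weights\<close>

lemma continuous_on_fst_comp:
  assumes "continuous_on UNIV f"
  shows "continuous_on A (\<lambda>p. f (fst p))"
  by (rule continuous_on_compose2[OF assms]) (auto intro: continuous_on_fst continuous_on_id)

lemma h_twist_continuous:
  assumes "continuous_on UNIV \<sigma>"
  shows "continuous_on A (h_twist \<sigma>)"
  unfolding h_twist_def case_prod_beta
  by (intro continuous_intros continuous_on_fst_comp[OF assms])

lemma h_twist_eq: "h_twist \<sigma> (s, t) = twist_factor (\<sigma> s) t"
  by (simp add: h_twist_def twist_factor_def)

lemma h_twist_pos: "0 < h_twist \<sigma> p"
  by (cases p) (simp add: h_twist_eq twist_factor_pos)

lemma h_twist_ge_1: "1 \<le> h_twist \<sigma> p"
  by (simp add: h_twist_def case_prod_beta)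

lemma weight_h_twist: "continuous_on UNIV \<sigma> \<Longrightarrow> weight a (h_twist \<sigma>)"
  by (simp add: weight_def h_twist_continuous h_twist_pos)

lemma h_ruled_continuous:
  assumes "continuous_on UNIV \<kappa>" "continuous_on UNIV \<tau>" "continuous_on UNIV \<theta>" "continuous_on UNIV (deriv \<theta>)"
  shows "continuous_on A (h_ruled \<kappa> \<tau> \<theta>)"
proof -
  note assms[THEN continuous_on_fst_comp]
  then show ?thesis
    unfolding h_ruled_def case_prod_beta by (intro continuous_intros)
qed

text \<open>The extra weight \<eta> depends on s alone, so it is a nonnegative constant in the inner
  integral over t. This freedom admits the variable factor 1/2 - \<delta>(s).\<close>

lemma transverse_inequality_strip:
  assumes a: "a > 0" and \<sigma>: "continuous_on UNIV \<sigma>" "\<And>s. a * \<bar>\<sigma> s\<bar> \<le> sqrt 2"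
    and \<eta>: "continuous_on UNIV \<eta>" "\<And>s. 0 \<le> \<eta> s" and \<phi>: "\<phi> \<in> test_functions a"
  defines "g \<equiv> \<lambda>p. \<eta> (fst p) * (h_twist \<sigma> p * (cmod (partial2 \<phi> p))\<^sup>2 - E1 a * (h_twist \<sigma> p * (cmod (\<phi> p))\<^sup>2))"
  shows "integrable lborel g" "0 \<le> (LINT p|lborel. g p)"
proof -
  note \<phi>' = test_functions_partial(2)[OF \<phi>]
  have w: "continuous_on A (\<lambda>p. \<eta> (fst p) * h_twist \<sigma> p)" for A
    by (intro continuous_on_mult continuous_on_fst_comp h_twist_continuous \<sigma> \<eta>)
  have int: "integrable lborel (\<lambda>p. \<eta> (fst p) * h_twist \<sigma> p * (cmod (u p))\<^sup>2)"
    if "u \<in> test_functions a" for u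
    by (intro compactly_supported_in_integrable[of "strip a"] continuous_intros w
        test_functions_continuous[OF that]
        compactly_supported_in_comp[OF test_functions_compactly_supported[OF that]]) auto
  have "integrable lborel (\<lambda>p. \<eta> (fst p) * h_twist \<sigma> p * (cmod (partial2 \<phi> p))\<^sup>2
      - E1 a * (\<eta> (fst p) * h_twist \<sigma> p * (cmod (\<phi> p))\<^sup>2))"
    by (intro Bochner_Integration.integrable_diff integrable_mult_right int \<phi> \<phi>')
  also have "(\<lambda>p. \<eta> (fst p) * h_twist \<sigma> p * (cmod (partial2 \<phi> p))\<^sup>2
      - E1 a * (\<eta> (fst p) * h_twist \<sigma> p * (cmod (\<phi> p))\<^sup>2)) = g"
    by (auto simp: g_def algebra_simps)
  finally show g: "integrable lborel g" .
  obtain R b where b: "0 < b" "b < a" "\<And>s t. \<bar>s\<bar> > R \<or> \<bar>t\<bar> > b \<Longrightarrow> \<phi> (s, t) = 0"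
    using test_functions_support_box[OF \<phi> a] by metis
  have "0 \<le> (LINT t|lborel. g (s, t))" for s
  proof -
    have "continuous_on UNIV (\<lambda>t. partial2 \<phi> (s, t))"
      by (rule continuous_on_compose2[OF test_functions_continuous[OF \<phi>', of UNIV]])
        (auto intro: continuous_intros)
    from transverse_inequality[OF a \<sigma>(2) test_functions_partial_derivatives(2)[OF \<phi>] this b(1,2), of s] b(3)
    show ?thesis
      using \<eta>(2)[of s] by (simp add: g_def h_twist_eq)
  qed
  then show "0 \<le> (LINT p|lborel. g p)"
    by (simp add: lborel_prod_integral(1)[OF g])
qed

text \<open>The curvature decays around 0, the Hardy weight around \<open>s0\<close>. The factor
  paid for moving the centre is why the admissible curvature depends on \<open>s0\<close>.\<close>

lemma Hardy_weight_comparison: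
  fixes s s0 :: real
  shows "1 + (s - s0)\<^sup>2 \<le> 2 * (1 + s0\<^sup>2) * (1 + s\<^sup>2)"
proof -
  have "(s - s0)\<^sup>2 \<le> 2 * s\<^sup>2 + 2 * s0\<^sup>2"
    using zero_le_power2[of "s + s0"] by (simp add: power2_eq_square algebra_simps)
  moreover have "0 \<le> s0\<^sup>2 * s\<^sup>2"
    by simp
  moreover have "2 * (1 + s0\<^sup>2) * (1 + s\<^sup>2) = 2 + 2 * s\<^sup>2 + 2 * s0\<^sup>2 + 2 * (s0\<^sup>2 * s\<^sup>2)"
    by (simp add: algebra_simps)
  ultimately show ?thesis
    by linarith
qed

text \<open>Only the Hardy and the transverse inequality are integral statements. They are merged
  into one integrand, after which the comparison with the ruled strip holds at every point.\<close>

lemma ruled_energy_ge_of_Hardy_pair: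
  fixes \<kappa> \<tau> \<theta> :: "real \<Rightarrow> real"
  defines "\<sigma> \<equiv> \<lambda>s. \<tau> s - deriv \<theta> s"
  assumes a: "a > 0" and h: "weight a (h_ruled \<kappa> \<tau> \<theta>)"
    and \<sigma>: "continuous_on UNIV \<sigma>" "\<And>s. a * \<bar>\<sigma> s\<bar> \<le> sqrt 2"
    and hardy: "Hardy_pair a \<sigma> s0 c"
    and \<epsilon>: "0 \<le> \<epsilon>" "a * \<epsilon> \<le> 1 / 2" "8 * E1 a * (a * \<epsilon>) * (1 + s0\<^sup>2) \<le> c"
    and k: "\<And>s. \<bar>\<kappa> s * cos (\<theta> s)\<bar> \<le> \<epsilon> / (1 + s\<^sup>2)"
    and \<phi>: "\<phi> \<in> test_functions a"
  shows "E1 a * L2_norm_sq (strip_measure a (h_ruled \<kappa> \<tau> \<theta>)) \<phi>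
    \<le> energy a (h_ruled \<kappa> \<tau> \<theta>) (partial1 \<phi>) (partial2 \<phi>)"
proof -
  define h where "h = h_ruled \<kappa> \<tau> \<theta>"
  define h0 where "h0 = h_twist \<sigma>"
  define \<delta> where "\<delta> s = a * \<epsilon> / (1 + s\<^sup>2)" for s :: real
  let ?N = "\<lambda>u p. (cmod (u p))\<^sup>2" and ?E = "E1 a"
  note \<phi>' = test_functions_partial[OF \<phi>]
  have E: "0 \<le> ?E"
    by (simp add: E1_def)
  have wh: "weight a h" and wh0: "weight a h0"
    using h \<sigma>(1) by (auto simp: h_def h0_def weight_h_twist)
  have \<delta>: "0 \<le> \<delta> s" "\<delta> s \<le> 1 / 2" for s
  proof -
    show "0 \<le> \<delta> s"
      using a \<epsilon> by (simp add: \<delta>_def)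
    have "a * \<epsilon> / (1 + s\<^sup>2) \<le> a * \<epsilon> / 1"
      using a \<epsilon> by (intro divide_left_mono) (auto simp: add_pos_nonneg)
    then show "\<delta> s \<le> 1 / 2"
      using \<epsilon>(2) unfolding \<delta>_def by linarith
  qed
  have \<delta>_cont: "continuous_on UNIV \<delta>"
    unfolding \<delta>_def by (intro continuous_intros) (simp add: add_nonneg_eq_0_iff)
  have bounds: "(1 - \<delta> s) * h0 (s, t) \<le> h (s, t)" "h (s, t) \<le> (1 + \<delta> s) * h0 (s, t)"
      "(1 - \<delta> s) * (1 / h0 (s, t)) \<le> 1 / h (s, t)"
    if "(s, t) \<in> strip a" for s t
  proof -
    have "\<bar>t * (\<kappa> s * cos (\<theta> s))\<bar> \<le> a * (\<epsilon> / (1 + s\<^sup>2))"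
      unfolding abs_mult[of t] using that k[of s] a by (intro mult_mono) (auto simp: strip_def)
    then have x: "\<bar>t * (\<kappa> s * cos (\<theta> s))\<bar> \<le> \<delta> s"
      by (simp add: \<delta>_def)
    have \<delta>1: "\<delta> s < 1"
      using \<delta>(2)[of s] by simp
    show b: "(1 - \<delta> s) * h0 (s, t) \<le> h (s, t)" "h (s, t) \<le> (1 + \<delta> s) * h0 (s, t)"
      using h_ruled_twist_bounds[of t \<kappa> s \<theta> "\<delta> s" \<tau>, OF x \<delta>1] by (simp_all add: h_def h0_def \<sigma>_def)
    show "(1 - \<delta> s) * (1 / h0 (s, t)) \<le> 1 / h (s, t)"
      using b \<delta>1 \<delta>(1) by (intro reciprocal_ratio_bounds(2)) (auto simp: h0_def h_twist_pos)
  qed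
  note int = test_functions_weighted_integrable
  \<comment> \<open>1/2 - \<delta> is what remains of the factor 1 - \<delta> on the transverse
    energy after the Hardy inequality has used one half.\<close>
  let ?R = "\<lambda>p. (1 / 2 - \<delta> (fst p)) * (h0 p * ?N (partial2 \<phi>) p - ?E * (h0 p * ?N \<phi> p))"
  have R: "integrable lborel ?R" "0 \<le> (LINT p|lborel. ?R p)"
    unfolding h0_def
    by (rule transverse_inequality_strip[OF a \<sigma> _ _ \<phi>, of "\<lambda>s. 1 / 2 - \<delta> s"];
        use \<delta> \<delta>_cont in \<open>auto intro!: continuous_intros\<close>)+
  let ?H = "\<lambda>p. h0 p * (?N \<phi> p / (1 + (fst p - s0)\<^sup>2))"
  have cs: "compactly_supported_in (strip a) (\<lambda>p. ?N \<phi> p / (1 + (fst p - s0)\<^sup>2))"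
    by (intro compactly_supported_in_comp[OF test_functions_compactly_supported[OF \<phi>]]
        continuous_intros test_functions_continuous[OF \<phi>]) (auto simp: add_nonneg_eq_0_iff)
  have H_int: "integrable lborel ?H"
    using wh0 by (intro compactly_supported_in_integrable[of "strip a"] compactly_supported_in_comp[OF cs]
        continuous_intros compactly_supported_in_continuous[OF cs]) (auto simp: weight_def)
  let ?A = "\<lambda>p. 1 / h0 p * ?N (partial1 \<phi>) p" and ?B = "\<lambda>p. h0 p * ?N (partial2 \<phi>) p"
    and ?C = "\<lambda>p. h0 p * ?N \<phi> p"
  note ints = int[OF weight_inverse[OF wh0] \<phi>'(1)] int[OF wh0 \<phi>'(2)] int[OF wh0 \<phi>]
    int[OF weight_inverse[OF wh] \<phi>'(1)] int[OF wh \<phi>'(2)] int[OF wh \<phi>]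
  have combine: "(LINT p|lborel. 1 / 2 * (u p + v p - ?E * w p - c * x p) + y p)
      = 1 / 2 * ((LINT p|lborel. u p) + (LINT p|lborel. v p) - ?E * (LINT p|lborel. w p) - c * (LINT p|lborel. x p))
        + (LINT p|lborel. y p)"
    if "integrable lborel u" "integrable lborel v" "integrable lborel w" "integrable lborel x" "integrable lborel y"
    for u v w x y :: "real \<times> real \<Rightarrow> real"
    using that by simp
  have Hardy: "c * (LINT p|lborel. ?H p) \<le> (LINT p|lborel. ?A p) + (LINT p|lborel. ?B p) - ?E * (LINT p|lborel. ?C p)"
  proof -
    have "c * (LINT p|strip_measure a h0. ?N \<phi> p / (1 + (fst p - s0)\<^sup>2))
        \<le> energy a h0 (partial1 \<phi>) (partial2 \<phi>) - ?E * L2_norm_sq (strip_measure a h0) \<phi>"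
      using hardy test_functions_subset_W12_0[OF a \<phi>] test_functions_weak_gradient[OF a \<phi>]
      unfolding Hardy_pair_def h0_def by blast
    then show ?thesis
      by (simp only: test_functions_energy[OF wh0 \<phi>] test_functions_L2(2)[OF wh0 \<phi>]
          integral_strip_measure_compactly_supported(1)[OF wh0 cs] real_scaleR_def)
  qed
  have "0 \<le> 1 / 2 * ((LINT p|lborel. ?A p) + (LINT p|lborel. ?B p) - ?E * (LINT p|lborel. ?C p) - c * (LINT p|lborel. ?H p))
      + (LINT p|lborel. ?R p)"
    using Hardy R(2) by (intro add_nonneg_nonneg mult_nonneg_nonneg) auto
  also have "\<dots> = (LINT p|lborel. 1 / 2 * (?A p + ?B p - ?E * ?C p - c * ?H p) + ?R p)"
    by (rule combine[OF ints(1-3) H_int R(1), symmetric])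
  also have "\<dots> \<le> (LINT p|lborel. 1 / h p * ?N (partial1 \<phi>) p + h p * ?N (partial2 \<phi>) p - ?E * (h p * ?N \<phi> p))"
  proof (rule integral_mono)
    fix p :: "real \<times> real"
    obtain s t where p: "p = (s, t)"
      by (cases p)
    show "1 / 2 * (?A p + ?B p - ?E * ?C p - c * ?H p) + ?R p
        \<le> 1 / h p * ?N (partial1 \<phi>) p + h p * ?N (partial2 \<phi>) p - ?E * (h p * ?N \<phi> p)"
    proof (cases "p \<in> strip a")
      \<comment> \<open>The weights are comparable only inside the strip; outside it \<phi> and its
        derivatives vanish and both sides are 0.\<close>
      case False
      then show ?thesis
        using test_functions_compactly_supported[OF \<phi>] test_functions_compactly_supported[OF \<phi>'(1)]
          test_functions_compactly_supported[OF \<phi>'(2)]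
        by (simp add: compactly_supported_in_outside)
    next
      case True
      note b = bounds[of s t, folded p, OF True]
      have "1 / 2 * ?A p \<le> (1 - \<delta> s) * ?A p"
        using \<delta>(2)[of s] by (intro mult_right_mono) (auto simp: h0_def h_twist_pos less_imp_le)
      also have "\<dots> \<le> 1 / h p * ?N (partial1 \<phi>) p"
        using mult_right_mono[OF b(3), of "?N (partial1 \<phi>) p"] by (simp only: mult.assoc zero_le_power2)
      finally have 1: "1 / 2 * ?A p \<le> 1 / h p * ?N (partial1 \<phi>) p" .
      have 2: "(1 - \<delta> s) * ?B p \<le> h p * ?N (partial2 \<phi>) p"
        using mult_right_mono[OF b(1), of "?N (partial2 \<phi>) p"] by (simp only: mult.assoc zero_le_power2)
      have "h p * ?N \<phi> p \<le> (1 + \<delta> s) * ?C p"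
        using mult_right_mono[OF b(2), of "?N \<phi> p"] by (simp only: mult.assoc zero_le_power2)
      then have 3: "?E * (h p * ?N \<phi> p) \<le> ?E * ((1 + \<delta> s) * ?C p)"
        using E by (rule mult_left_mono)
      \<comment> \<open>The 8 in the hypothesis on \<epsilon> is a product of three factors 2: the
        mass excess 2 \<delta>, the halved Hardy term, and the change of centre from 0 to
        \<open>s0\<close>.\<close>
      have "2 * ?E * \<delta> s \<le> c / 2 / (1 + (s - s0)\<^sup>2)"
      proof -
        have "4 * ?E * (a * \<epsilon>) * (1 + (s - s0)\<^sup>2) \<le> 4 * ?E * (a * \<epsilon>) * (2 * (1 + s0\<^sup>2) * (1 + s\<^sup>2))"
          using E a \<epsilon> by (intro mult_left_mono Hardy_weight_comparison) auto
        also have "\<dots> = 8 * ?E * (a * \<epsilon>) * (1 + s0\<^sup>2) * (1 + s\<^sup>2)"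
          by simp
        also have "\<dots> \<le> c * (1 + s\<^sup>2)"
          using \<epsilon>(3) by (intro mult_right_mono) auto
        finally have le: "4 * ?E * (a * \<epsilon>) * (1 + (s - s0)\<^sup>2) \<le> c * (1 + s\<^sup>2)" .
        have pos: "0 < 1 + s\<^sup>2" "0 < 1 + (s - s0)\<^sup>2"
          by (simp_all add: add_pos_nonneg)
        have "2 * ?E * (a * \<epsilon>) / (1 + s\<^sup>2) \<le> c / 2 / (1 + (s - s0)\<^sup>2)"
        proof -
          have "x / u \<le> y / 2 / v" if "2 * x * v \<le> y * u" "0 < u" "0 < v" for x y u v :: real
            using that by (simp add: field_simps)
          from this[of "2 * ?E * (a * \<epsilon>)", OF _ pos] show ?thesis
            using le by simp
        qed
        then show ?thesis
          by (simp add: \<delta>_def)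
      qed
      then have "2 * ?E * \<delta> s * ?C p \<le> c / 2 / (1 + (s - s0)\<^sup>2) * ?C p"
        by (rule mult_right_mono) (simp add: h0_def h_twist_pos less_imp_le)
      also have "\<dots> = 1 / 2 * (c * ?H p)"
        by (simp add: p)
      finally have 4: "2 * ?E * \<delta> s * ?C p \<le> 1 / 2 * (c * ?H p)" .
      \<comment> \<open>The mass carries 1 + \<delta> = (1 - \<delta>) + 2 \<delta>. The first part
        matches the factor of the transverse gradient, and the second is charged to the Hardy
        term.\<close>
      have "1 / 2 * (?A p + ?B p - ?E * ?C p - c * ?H p) + ?R p
          = 1 / 2 * ?A p + (1 - \<delta> s) * ?B p - ?E * ((1 + \<delta> s) * ?C p)
            + (2 * ?E * \<delta> s * ?C p - 1 / 2 * (c * ?H p))"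
        by (simp add: p algebra_simps)
      then show ?thesis
        using 1 2 3 4 by linarith
    qed
  qed (intro Bochner_Integration.integrable_add Bochner_Integration.integrable_diff
      integrable_mult_right ints R(1) H_int)+
  also have "\<dots> = energy a h (partial1 \<phi>) (partial2 \<phi>) - ?E * L2_norm_sq (strip_measure a h) \<phi>"
    unfolding test_functions_energy[OF wh \<phi>] test_functions_L2(2)[OF wh \<phi>]
    using Bochner_Integration.integral_diff[OF Bochner_Integration.integrable_add[OF ints(4,5)]
        integrable_mult_right[OF ints(6), of ?E]]
      Bochner_Integration.integral_add[OF ints(4,5)]
    by simp
  finally show ?thesis
    by (simp add: h_def)
qed

section \<open>Choice of the curvature threshold and passage to the form domain\<close>

theorem theorem2:
  fixes a c s0 :: real
  assumes "a > 0" and "c > 0"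
  shows "\<exists>C>0. \<forall>(\<kappa> :: real \<Rightarrow> real) (\<tau> :: real \<Rightarrow> real) (\<theta> :: real \<Rightarrow> real) (\<epsilon>0 :: real).
     continuous_on UNIV \<kappa> \<longrightarrow> bounded (range \<kappa>) \<longrightarrow>
     continuous_on UNIV \<tau> \<longrightarrow> bounded (range \<tau>) \<longrightarrow>
     (\<forall>s. \<kappa> s > 0) \<or> (\<forall>s. \<kappa> s = 0 \<and> \<tau> s = 0) \<longrightarrow>
     bounded (range \<theta>) \<longrightarrow> (\<forall>s. \<theta> differentiable (at s)) \<longrightarrow>
     continuous_on UNIV (deriv \<theta>) \<longrightarrow> bounded (range (deriv \<theta>)) \<longrightarrow>
     (\<exists>s. \<tau> s - deriv \<theta> s \<noteq> 0) \<longrightarrow>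
     a * (SUP s. \<bar>\<tau> s - deriv \<theta> s\<bar>) < sqrt 2 \<longrightarrow>
     Hardy_pair a (\<lambda>s. \<tau> s - deriv \<theta> s) s0 c \<longrightarrow>
     0 \<le> \<epsilon>0 \<longrightarrow> \<epsilon>0 < inverse a \<longrightarrow>
     (\<forall>s. \<bar>\<kappa> s * cos (\<theta> s)\<bar> \<le> \<epsilon>0 / (1 + s\<^sup>2)) \<longrightarrow>
     \<epsilon>0 \<le> C \<longrightarrow>
     (\<forall>\<psi>\<in>W12_0 a.
        Dirichlet_form a (h_ruled \<kappa> \<tau> \<theta>) \<psi>
        \<ge> E1 a * L2_norm_sq (strip_measure a (h_ruled \<kappa> \<tau> \<theta>)) \<psi>)"
proof -
  \<comment> \<open>\<open>K\<close> is the coefficient of \<epsilon> in the smallness condition of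
    \<open>ruled_energy_ge_of_Hardy_pair\<close>, so that condition reads \<epsilon>0 \<le> c /
    K.\<close>
  define K where "K = 8 * E1 a * a * (1 + s0\<^sup>2)"
  have "0 < E1 a" "0 < 1 + s0\<^sup>2"
    using assms by (auto simp: E1_def add_pos_nonneg)
  then have K: "0 < K"
    using assms by (simp add: K_def)
  show ?thesis
  \<comment> \<open>The first bound gives a \<epsilon>0 \<le> 1/2, hence \<delta> \<le> 1/2; the
    second lets the Hardy term absorb the mass excess.\<close>
  proof (intro exI[of _ "min (1 / (2 * a)) (c / K)"] conjI allI impI ballI)
    show "0 < min (1 / (2 * a)) (c / K)"
      using assms K by simp
  next
    fix \<kappa> \<tau> \<theta> :: "real \<Rightarrow> real" and \<epsilon>0 :: real and \<psi> :: "real \<times> real \<Rightarrow> complex"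
    let ?\<sigma> = "\<lambda>s. \<tau> s - deriv \<theta> s" and ?h = "h_ruled \<kappa> \<tau> \<theta>"
    assume \<kappa>: "continuous_on UNIV \<kappa>" and \<tau>: "continuous_on UNIV \<tau>" "bounded (range \<tau>)"
      and \<theta>: "\<forall>s. \<theta> differentiable (at s)" "continuous_on UNIV (deriv \<theta>)" "bounded (range (deriv \<theta>))"
      and sup: "a * (SUP s. \<bar>?\<sigma> s\<bar>) < sqrt 2" and hardy: "Hardy_pair a ?\<sigma> s0 c"
      and \<epsilon>0: "0 \<le> \<epsilon>0" and k: "\<forall>s. \<bar>\<kappa> s * cos (\<theta> s)\<bar> \<le> \<epsilon>0 / (1 + s\<^sup>2)"
      and C: "\<epsilon>0 \<le> min (1 / (2 * a)) (c / K)" and \<psi>: "\<psi> \<in> W12_0 a"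
    have a\<epsilon>: "a * \<epsilon>0 \<le> 1 / 2" and K\<epsilon>: "8 * E1 a * (a * \<epsilon>0) * (1 + s0\<^sup>2) \<le> c"
      using C assms K by (simp_all add: field_simps K_def)
    have \<sigma>_cont: "continuous_on UNIV ?\<sigma>"
      by (intro continuous_on_diff \<tau> \<theta>)
    have \<sigma>_le: "a * \<bar>?\<sigma> s\<bar> \<le> sqrt 2" for s
    proof -
      \<comment> \<open>A real supremum bounds its family only if the family is bounded above; this
        comes from the bounds on \<tau> and on the derivative of \<theta>.\<close>
      obtain B1 B2 where "\<And>s. \<bar>\<tau> s\<bar> \<le> B1" "\<And>s. \<bar>deriv \<theta> s\<bar> \<le> B2"
        using \<tau>(2) \<theta>(3) by (auto simp: bounded_iff)
      then have "\<bar>?\<sigma> s\<bar> \<le> B1 + B2" for s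
        using abs_triangle_ineq4[of "\<tau> s" "deriv \<theta> s"] add_mono order_trans by blast
      then have "bdd_above (range (\<lambda>s. \<bar>?\<sigma> s\<bar>))"
        by (auto simp: bdd_above_def)
      then have "\<bar>?\<sigma> s\<bar> \<le> (SUP s. \<bar>?\<sigma> s\<bar>)"
        by (rule cSUP_upper[OF UNIV_I])
      then have "a * \<bar>?\<sigma> s\<bar> \<le> a * (SUP s. \<bar>?\<sigma> s\<bar>)"
        using assms by (intro mult_left_mono) auto
      then show ?thesis
        using sup by simp
    qed
    have \<theta>_cont: "continuous_on UNIV \<theta>"
      using \<theta>(1) by (intro continuous_at_imp_continuous_on) (auto intro: differentiable_imp_continuous_within)
    \<comment> \<open>The ratio of the ruled to the twisted weight lies between 1/2 and 3/2, and the
      twisted weight between 1 and sqrt 3 \<le> 2. Hence 3 bounds both the ruled weight and its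
      reciprocal.\<close>
    have bounds: "1 / 2 \<le> ?h p" "?h p \<le> 3" if "p \<in> strip a" for p
    proof -
      obtain s t where p: "p = (s, t)"
        by (cases p)
      have "\<bar>t * (\<kappa> s * cos (\<theta> s))\<bar> \<le> a * (\<epsilon>0 / (1 + s\<^sup>2))"
        unfolding abs_mult[of t] using that k assms by (intro mult_mono) (auto simp: strip_def p)
      also have "\<dots> \<le> a * (\<epsilon>0 / 1)"
        using assms \<epsilon>0 by (intro mult_left_mono divide_left_mono) (auto simp: add_pos_nonneg)
      finally have "\<bar>t * (\<kappa> s * cos (\<theta> s))\<bar> \<le> 1 / 2"
        using a\<epsilon> by simp
      note b = h_ruled_twist_bounds[of t \<kappa> s \<theta> "1 / 2" \<tau>, OF this]
      have "\<bar>t\<bar> * \<bar>?\<sigma> s\<bar> \<le> a * \<bar>?\<sigma> s\<bar>"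
        using that by (intro mult_right_mono) (auto simp: strip_def p)
      then have "\<bar>t * ?\<sigma> s\<bar> \<le> sqrt 2"
        using \<sigma>_le[of s] by (simp add: abs_mult)
      then have "(t * ?\<sigma> s)\<^sup>2 \<le> 2"
        using power_mono[of "\<bar>t * ?\<sigma> s\<bar>" "sqrt 2" 2] by simp
      then have "h_twist ?\<sigma> (s, t) \<le> 2"
        by (auto simp: h_twist_def power_mult_distrib intro!: real_le_lsqrt)
      then show "1 / 2 \<le> ?h p" "?h p \<le> 3"
        using b h_twist_ge_1[of ?\<sigma> "(s, t)"] by (auto simp: p)
    qed
    have h: "weight a ?h"
      unfolding weight_def
    proof (intro conjI ballI h_ruled_continuous \<kappa> \<tau> \<theta> \<theta>_cont)
      show "0 < ?h p" if "p \<in> strip a" for p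
        using bounds(1)[OF that] by simp
    qed
    show "E1 a * L2_norm_sq (strip_measure a ?h) \<psi> \<le> Dirichlet_form a ?h \<psi>"
    proof (rule Dirichlet_form_ge[OF assms(1) h _ _ _ \<psi>])
      show "?h p \<le> 3" "1 / ?h p \<le> 3" if "p \<in> strip a" for p
        using bounds[OF that] by (auto simp: divide_le_eq)
      show "E1 a * L2_norm_sq (strip_measure a ?h) \<phi> \<le> energy a ?h (partial1 \<phi>) (partial2 \<phi>)"
        if "\<phi> \<in> test_functions a" for \<phi>
        using assms(1) h \<sigma>_cont \<sigma>_le hardy \<epsilon>0 a\<epsilon> K\<epsilon> k that by (intro ruled_energy_ge_of_Hardy_pair) auto
    qed
  qed
qed

end
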